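(* Let $d\ge2$ be an integer, let $p$ be a prime, and let $\mu$ be a symmetric probability measure on $\mathbb{F}_p^d\rtimes \mathrm{SL}_d(\mathbb{F}_p)$ such that $$\|\mu.\delta_x\|_{L^2}\le \tfrac34\quad\text{for all }x\in\mathbb{F}_p^d,\qquad\text{and}\qquad \|\mathcal{L}_0^\theta(\mu)\|\le\tfrac12 .$$ Let $v_0\in\mathbb{F}_p^d$ be arbitrary and put $\eta_l=\mu^{*(l)}.\delta_{v_0}$ for each integer $l\ge 0$. Then for $l=\lfloor 2^{15}d\log p\rfloor$ we have $$\|\eta_l\|_{L^\infty}\le\|\eta_l\|_{L^2}\le 4p^{-d/4}.$$
   Context: Write $G=\mathbb{F}_p^d\rtimes \mathrm{SL}_d(\mathbb{F}_p)$, with product $(v_1,\theta_1)\cdot(v_2,\theta_2)=(v_1+\theta_1v_2,\theta_1\theta_2)$. For $g=(v,\theta)\in G$ write $\theta(g)=\theta$, and let $G$ act on $\mathbb{F}_p^d$ by $g.x=v+\theta x$. A measure on a finite set is identified with its density with respect to counting measure. $\mu$ is symmetric if $\mu(g)=\mu(g^{-1})$ for all $g$. $\mu^{*(l)}$ is the $l$-fold convolution of $\mu$ with itself (with $\mu^{*(0)}$ the point mass at the identity), $\delta_x$ is the point mass at $x$, and for a measure $\nu$ on $\mathbb{F}_p^d$, $[\mu.\nu](x)=\sum_{g\in G}\mu(g)\nu(g^{-1}.x)$. Norms on $\mathbb{F}_p^d$: $\|f\|_{L^2}=(\sum_x|f(x)|^2)^{1/2}$, $\|f\|_{L^\infty}=\max_x|f(x)|$.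 $\log$ is the natural logarithm. $\mathcal{L}_0^\theta(\mu)$ is the operator $f\mapsto \sum_{g\in G}\mu(g)f(\theta(g)^{-1}\,\cdot\,)$ on the space of functions in $\mathbb{C}[\mathrm{SL}_d(\mathbb{F}_p)]$ orthogonal to the constants, and $\|\mathcal{L}_0^\theta(\mu)\|$ is its operator norm with respect to the $L^2$ norm for counting measure. *)

theory Defs
  imports
    "HOL-Analysis.Analysis"
    "HOL-Algebra.Group"
    "Berlekamp_Zassenhaus.Finite_Field"
begin

text \<open>
  The prime \<open>p\<close> is \<open>CARD('p)\<close> and the dimension \<open>d\<close> is \<open>CARD('d)\<close>.  Since groups are given by
  explicit carriers, measures and functions on them are total functions on the ambient type of
  which only the values on the carrier matter: every sum and every norm below ranges over the
  carrier.
\<close>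

type_synonym ('p, 'd) Fvec = "'p mod_ring ^ 'd"
type_synonym ('p, 'd) Fmat = "'p mod_ring ^ 'd ^ 'd"

definition SL :: "('p::prime_card, 'd::finite) Fmat monoid" where
  "SL = \<lparr>carrier = {\<theta>. det \<theta> = 1}, monoid.mult = (\<lambda>A B. A ** B), one = mat 1\<rparr>"

definition ASL :: "(('p::prime_card, 'd::finite) Fvec \<times> ('p, 'd) Fmat) monoid" where
  "ASL = \<lparr>carrier = UNIV \<times> carrier SL,
          monoid.mult = (\<lambda>(v1, \<theta>1) (v2, \<theta>2). (v1 + \<theta>1 *v v2, \<theta>1 ** \<theta>2)),
          one = (0, mat 1)\<rparr>"

definition aff_act ::
  "('p::prime_card, 'd::finite) Fvec \<times> ('p, 'd) Fmat \<Rightarrow> ('p, 'd) Fvec \<Rightarrow> ('p, 'd) Fvec" where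
  "aff_act g x = fst g + snd g *v x"

definition prob_measure_on :: "'a set \<Rightarrow> ('a \<Rightarrow> real) \<Rightarrow> bool" where
  "prob_measure_on A \<mu> \<longleftrightarrow> (\<forall>a\<in>A. 0 \<le> \<mu> a) \<and> (\<Sum>a\<in>A. \<mu> a) = 1"

definition symmetric_measure :: "('a, 'b) monoid_scheme \<Rightarrow> ('a \<Rightarrow> real) \<Rightarrow> bool" where
  "symmetric_measure G \<mu> \<longleftrightarrow> (\<forall>g\<in>carrier G. \<mu> g = \<mu> (inv\<^bsub>G\<^esub> g))"

definition point_mass :: "'a \<Rightarrow> 'a \<Rightarrow> real" where
  "point_mass x y = (if y = x then 1 else 0)"

definition convolution ::
  "('a, 'b) monoid_scheme \<Rightarrow> ('a \<Rightarrow> real) \<Rightarrow> ('a \<Rightarrow> real) \<Rightarrow> 'a \<Rightarrow> real" where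
  "convolution G \<mu> \<nu> g = (\<Sum>h\<in>carrier G. \<mu> h * \<nu> (inv\<^bsub>G\<^esub> h \<otimes>\<^bsub>G\<^esub> g))"

primrec conv_power :: "('a, 'b) monoid_scheme \<Rightarrow> ('a \<Rightarrow> real) \<Rightarrow> nat \<Rightarrow> 'a \<Rightarrow> real" where
  "conv_power G \<mu> 0 = point_mass \<one>\<^bsub>G\<^esub>"
| "conv_power G \<mu> (Suc l) = convolution G \<mu> (conv_power G \<mu> l)"

definition measure_act ::
  "(('p::prime_card, 'd::finite) Fvec \<times> ('p, 'd) Fmat \<Rightarrow> real) \<Rightarrow>
    (('p, 'd) Fvec \<Rightarrow> real) \<Rightarrow> ('p, 'd) Fvec \<Rightarrow> real" where
  "measure_act \<mu> \<nu> x = (\<Sum>g\<in>carrier ASL. \<mu> g * \<nu> (aff_act (inv\<^bsub>ASL\<^esub> g) x))"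

definition L2_norm_on :: "'a set \<Rightarrow> ('a \<Rightarrow> 'b::real_normed_vector) \<Rightarrow> real" where
  "L2_norm_on A f = L2_set (\<lambda>x. norm (f x)) A"

definition Linf_norm_on :: "'a set \<Rightarrow> ('a \<Rightarrow> 'b::real_normed_vector) \<Rightarrow> real" where
  "Linf_norm_on A f = Max ((\<lambda>x. norm (f x)) ` A)"

definition orthogonal_to_constants :: "'a set \<Rightarrow> ('a \<Rightarrow> complex) set" where
  "orthogonal_to_constants A = {f. \<forall>c. (\<Sum>x\<in>A. f x * cnj c) = 0}"

definition L2_op_norm_on ::
  "'a set \<Rightarrow> ('a \<Rightarrow> complex) set \<Rightarrow> (('a \<Rightarrow> complex) \<Rightarrow> 'a \<Rightarrow> complex) \<Rightarrow> real" where
  "L2_op_norm_on A V T = Sup {L2_norm_on A (T f) |f. f \<in> V \<and> L2_norm_on A f \<le> 1}"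

definition theta_operator ::
  "(('p::prime_card, 'd::finite) Fvec \<times> ('p, 'd) Fmat \<Rightarrow> real) \<Rightarrow>
    (('p, 'd) Fmat \<Rightarrow> complex) \<Rightarrow> ('p, 'd) Fmat \<Rightarrow> complex" where
  "theta_operator \<mu> f h =
    (\<Sum>g\<in>carrier ASL. complex_of_real (\<mu> g) * f (inv\<^bsub>SL\<^esub> (snd g) \<otimes>\<^bsub>SL\<^esub> h))"

definition theta_operator_norm ::
  "(('p::prime_card, 'd::finite) Fvec \<times> ('p, 'd) Fmat \<Rightarrow> real) \<Rightarrow> real" where
  "theta_operator_norm \<mu> =
    L2_op_norm_on (carrier SL) (orthogonal_to_constants (carrier SL)) (theta_operator \<mu>)"


text \<open>The structures above are groups, so that \<open>inv\<close> has its intended meaning.\<close>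

lemma SL_group: "group (SL :: ('p::prime_card, 'd::finite) Fmat monoid)"
proof (rule groupI)
  fix x :: "('p, 'd) Fmat"
  assume "x \<in> carrier SL"
  then have x: "det x = 1"
    by (simp add: SL_def)
  then have "invertible x"
    by (simp add: invertible_det_nz)
  then obtain y where y: "y ** x = mat 1"
    by (auto simp: invertible_def)
  then have "det y = 1"
    using det_mul[of y x] x by simp
  with y show "\<exists>y\<in>carrier SL. y \<otimes>\<^bsub>SL\<^esub> x = \<one>\<^bsub>SL\<^esub>"
    by (auto simp: SL_def)
qed (auto simp: SL_def det_mul matrix_mul_assoc)

lemma ASL_group: "group (ASL :: (('p::prime_card, 'd::finite) Fvec \<times> ('p, 'd) Fmat) monoid)"
proof (rule groupI)
  fix g :: "('p, 'd) Fvec \<times> ('p, 'd) Fmat"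
  assume g: "g \<in> carrier ASL"
  obtain v \<theta> where [simp]: "g = (v, \<theta>)"
    by fastforce
  have "\<theta> \<in> carrier SL"
    using g by (simp add: ASL_def)
  then obtain y where y: "y \<in> carrier SL" "y \<otimes>\<^bsub>SL\<^esub> \<theta> = \<one>\<^bsub>SL\<^esub>"
    using group.l_inv_ex[OF SL_group] by metis
  have "(- (y *v v), y) \<in> carrier ASL"
    using y by (simp add: ASL_def)
  moreover have "(- (y *v v), y) \<otimes>\<^bsub>ASL\<^esub> g = \<one>\<^bsub>ASL\<^esub>"
    using y by (simp add: ASL_def SL_def)
  ultimately show "\<exists>h\<in>carrier ASL. h \<otimes>\<^bsub>ASL\<^esub> g = \<one>\<^bsub>ASL\<^esub>"
    by blast
qed (auto simp: ASL_def SL_def det_mul matrix_mul_assoc matrix_vector_mul_assoc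
    matrix_vector_right_distrib add.assoc)

lemma aff_act_one: "aff_act \<one>\<^bsub>ASL\<^esub> x = x"
  by (simp add: aff_act_def ASL_def)

lemma aff_act_mult: "aff_act (g \<otimes>\<^bsub>ASL\<^esub> h) x = aff_act g (aff_act h x)"
  by (cases g; cases h)
    (simp add: aff_act_def ASL_def matrix_vector_mul_assoc matrix_vector_right_distrib add.assoc)


text \<open>The supremum defining the operator norm is taken over a non-empty bounded set.\<close>

lemma theta_operator_norm_set_nonempty:
  "{L2_norm_on A (T f) |f. f \<in> orthogonal_to_constants A \<and> L2_norm_on A f \<le> 1} \<noteq> {}"
proof -
  have "(\<lambda>_. 0) \<in> orthogonal_to_constants A \<and> L2_norm_on A (\<lambda>_. 0 :: complex) \<le> 1"
    by (simp add: orthogonal_to_constants_def L2_norm_on_def L2_set_def)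
  then show ?thesis
    by blast
qed

lemma theta_operator_norm_set_bounded:
  fixes \<mu> :: "('p::prime_card, 'd::finite) Fvec \<times> ('p, 'd) Fmat \<Rightarrow> real"
  shows "bdd_above {L2_norm_on (carrier SL) (theta_operator \<mu> f) |f.
    f \<in> orthogonal_to_constants (carrier SL) \<and> L2_norm_on (carrier SL) f \<le> 1}"
proof (rule bdd_aboveI)
  fix r
  let ?B = "\<Sum>h\<in>carrier (SL :: ('p, 'd) Fmat monoid). \<Sum>g\<in>carrier ASL. \<bar>\<mu> g\<bar>"
  assume "r \<in> {L2_norm_on (carrier SL) (theta_operator \<mu> f) |f.
    f \<in> orthogonal_to_constants (carrier SL) \<and> L2_norm_on (carrier SL) f \<le> 1}"
  then obtain f where r: "r = L2_norm_on (carrier SL) (theta_operator \<mu> f)"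
    and f: "L2_norm_on (carrier SL) f \<le> 1"
    by blast
  have f_le: "norm (f \<theta>) \<le> 1" if "\<theta> \<in> carrier SL" for \<theta>
    using member_le_L2_set[OF finite that, of "\<lambda>x. norm (f x)"] f
    by (simp add: L2_norm_on_def)
  have "r \<le> (\<Sum>h\<in>carrier SL. norm (theta_operator \<mu> f h))"
    using L2_set_le_sum_abs[of "\<lambda>h. norm (theta_operator \<mu> f h)" "carrier SL"]
    by (simp add: r L2_norm_on_def)
  also have "\<dots> \<le> ?B"
  proof (rule sum_mono)
    fix h :: "('p, 'd) Fmat"
    assume h: "h \<in> carrier SL"
    show "norm (theta_operator \<mu> f h) \<le> (\<Sum>g\<in>carrier ASL. \<bar>\<mu> g\<bar>)"
      unfolding theta_operator_def
    proof (rule sum_norm_le)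
      fix g :: "('p, 'd) Fvec \<times> ('p, 'd) Fmat"
      assume "g \<in> carrier ASL"
      then have "snd g \<in> carrier SL"
        by (auto simp: ASL_def)
      then have "inv\<^bsub>SL\<^esub> (snd g) \<otimes>\<^bsub>SL\<^esub> h \<in> carrier SL"
        by (intro monoid.m_closed[OF group.is_monoid[OF SL_group]]
            group.inv_closed[OF SL_group] h)
      from f_le[OF this]
      show "norm (complex_of_real (\<mu> g) * f (inv\<^bsub>SL\<^esub> (snd g) \<otimes>\<^bsub>SL\<^esub> h)) \<le> \<bar>\<mu> g\<bar>"
        by (simp add: norm_mult mult_left_le)
    qed
  qed
  finally show "r \<le> ?B" .
qed

end

theory Submission
  imports Defs
begin

text \<open>
  Write \<open>q\<close> for the number \<open>p ^ d\<close> of vectors.  The heart of the matter is that a step of the walk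
  shrinks the \<open>L\<^sup>2\<close> norm of a probability density \<open>f\<close> by the factor \<open>1 - 1 / 2 ^ 17\<close> as long as
  this norm is at least \<open>4 / q powr (1 / 4)\<close> (\<open>contraction_step\<close>).  Since the norm starts at \<open>1\<close> and
  never grows, iterating this gives the theorem (\<open>walk_L2_decay\<close>, \<open>geometric_decay_le_powr\<close>).

  Suppose that a step does not shrink \<open>f\<close>, and let \<open>\<phi> = f / \<parallel>f\<parallel>\<close>.  An average of unit vectors
  has norm close to \<open>1\<close> only if the vectors are close to each other (\<open>pair_variance\<close>), so typical
  translates \<open>g.\<phi>\<close> and \<open>h.\<phi>\<close> are close.  The spectral gap concerns the linear parts of \<open>g\<close> and
  \<open>h\<close> only.  The translation parts disappear upon passing to the autocorrelation \<open>A\<close> of the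
  probability density \<open>\<phi>\<^sup>2\<close>, which is the law of a difference of two independent samples.  Its
  square root \<open>B\<close> is a unit vector that is almost invariant under the linear parts.  As \<open>SL\<close> acts
  transitively on the non-zero vectors for \<open>d \<ge> 2\<close>, the gap of the regular representation yields
  a gap for functions on non-zero vectors (\<open>SL_gap_on_nonzero\<close>), and hence \<open>B\<close> is nearly constant
  there (\<open>almost_invariant_autocorrelation_flat\<close>).

  But \<open>B\<close> has little room for a flat part: its sum is at most \<open>(\<Sum>\<phi>)\<^sup>2 = 1 / \<parallel>f\<parallel>\<^sup>2\<close>, which is at
  most \<open>sqrt q / 16\<close>, whereas a constant function of norm near \<open>1\<close> has sum near \<open>sqrt q\<close>
  (\<open>sum_sqrt_autocorrelation_le\<close>).  So nearly all of the mass of \<open>A\<close> sits at \<open>0\<close>: two independent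
  samples of \<open>\<phi>\<^sup>2\<close> nearly always coincide, and \<open>\<phi>\<close> is close to a point mass
  (\<open>almost_invariant_spread_concentrated\<close>).  Point masses are shrunk to norm at most \<open>3 / 4\<close>, a
  contradiction (\<open>concentrated_contracts\<close>).
\<close>

section \<open>The linear and affine groups and their actions\<close>

lemma carrier_SL_iff: "A \<in> carrier SL \<longleftrightarrow> det A = 1"
  by (simp add: SL_def)

lemma mult_SL: "A \<otimes>\<^bsub>SL\<^esub> B = A ** B"
  by (simp add: SL_def)

lemma carrier_ASL_iff: "g \<in> carrier ASL \<longleftrightarrow> snd g \<in> carrier SL"
  by (cases g) (simp add: ASL_def)

lemma snd_mult_ASL: "snd (g \<otimes>\<^bsub>ASL\<^esub> h) = snd g ** snd h"
  by (cases g; cases h) (simp add: ASL_def)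

lemma snd_inv_ASL:
  assumes "g \<in> carrier ASL"
  shows "snd (inv\<^bsub>ASL\<^esub> g) = inv\<^bsub>SL\<^esub> (snd g)"
proof -
  have "inv\<^bsub>ASL\<^esub> g \<in> carrier ASL"
    by (rule group.inv_closed[OF ASL_group assms])
  moreover have "snd (inv\<^bsub>ASL\<^esub> g) \<otimes>\<^bsub>SL\<^esub> snd g = \<one>\<^bsub>SL\<^esub>"
    using group.l_inv[OF ASL_group assms] snd_mult_ASL[of "inv\<^bsub>ASL\<^esub> g" g]
    by (simp add: SL_def ASL_def)
  ultimately show ?thesis
    using assms group.inv_equality[OF SL_group] by (metis carrier_ASL_iff)
qed

lemma aff_act_add: "aff_act g (x + y) = aff_act g x + snd g *v y"
  by (simp add: aff_act_def matrix_vector_right_distrib add.assoc)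

lemma bij_SL_act:
  assumes "\<theta> \<in> carrier SL"
  shows "bij ((*v) \<theta>)"
proof -
  have "inv\<^bsub>SL\<^esub> \<theta> ** \<theta> = mat 1"
    using group.l_inv[OF SL_group assms] by (simp add: SL_def)
  then have "inj ((*v) \<theta>)"
    by (metis injI matrix_vector_mul_assoc matrix_vector_mul_lid)
  then show ?thesis
    by (simp add: bij_betw_def finite_UNIV_inj_surj)
qed

lemma bij_aff_act:
  assumes "g \<in> carrier ASL"
  shows "bij (aff_act g)"
proof -
  have "inj (aff_act g)"
    by (metis injI aff_act_mult aff_act_one group.l_inv[OF ASL_group assms])
  then show ?thesis
    by (simp add: bij_betw_def finite_UNIV_inj_surj)
qed

lemma SL_act_eq_0_iff:
  assumes "\<theta> \<in> carrier SL"
  shows "\<theta> *v x = 0 \<longleftrightarrow> x = 0"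
  using bij_is_inj[OF bij_SL_act[OF assms]]
  by (metis injD matrix_vector_mult_0_right)

lemma bij_SL_act_nonzero:
  assumes "\<theta> \<in> carrier SL"
  shows "bij_betw ((*v) \<theta>) (- {0}) (- {0})"
proof -
  have inj: "inj_on ((*v) \<theta>) (- {0})"
    using bij_is_inj[OF bij_SL_act[OF assms]] by (rule inj_on_subset) simp
  then have "(*v) \<theta> ` (- {0}) = - {0}"
    by (intro endo_inj_surj) (auto simp: SL_act_eq_0_iff[OF assms])
  with inj show ?thesis
    by (simp add: bij_betw_def)
qed

text \<open>
  Elementary matrices add a multiple of one coordinate to another one.  They have determinant
  \<open>1\<close> because the determinant is invariant under row operations.
\<close>

lemma transvection_exists:
  fixes c :: "'p::prime_card mod_ring" and i j :: "'d::finite"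
  assumes "i \<noteq> j"
  shows "\<exists>\<theta>\<in>carrier SL. \<forall>x. \<theta> *v x = (\<chi> k. if k = i then x $ i + c * x $ j else x $ k)"
proof -
  define \<theta> :: "('p, 'd) Fmat" where
    "\<theta> = (\<chi> k. if k = i then row i (mat 1) + c *s row j (mat 1) else row k (mat 1))"
  have "det \<theta> = 1"
    unfolding \<theta>_def using det_row_operation[OF assms, of "mat 1" c] by simp
  moreover have "(\<theta> *v x) $ k = (if k = i then x $ i + c * x $ j else x $ k)" for x k
  proof -
    have row: "(\<Sum>m\<in>UNIV. (if a = m then 1 else 0) * x $ m) = x $ a" for a
      by (simp add: if_distrib[of "\<lambda>t. t * _"] cong: if_cong)
    have "(\<theta> *v x) $ i = (\<Sum>m\<in>UNIV. (if i = m then 1 else 0) * x $ m)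
        + c * (\<Sum>m\<in>UNIV. (if j = m then 1 else 0) * x $ m)"
      by (simp add: \<theta>_def matrix_vector_mult_def row_def mat_def sum_distrib_left
          distrib_right mult.assoc flip: sum.distrib)
    moreover have "(\<theta> *v x) $ k = (\<Sum>m\<in>UNIV. (if k = m then 1 else 0) * x $ m)" if "k \<noteq> i"
      using that by (simp add: \<theta>_def matrix_vector_mult_def row_def mat_def)
    ultimately show ?thesis
      by (simp only: row split: if_splits) simp
  qed
  ultimately show ?thesis
    by (auto simp: carrier_SL_iff vec_eq_iff intro!: bexI[of _ \<theta>])
qed

text \<open>
  Lying in one \<open>SL\<close>-orbit, as a relation: the path that proves transitivity on non-zero
  vectors is a chain of transvections, composed with the rules below.
\<close>

definition SL_equivalent :: "('p::prime_card, 'd::finite) Fvec \<Rightarrow> ('p, 'd) Fvec \<Rightarrow> bool" where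
  "SL_equivalent x y \<longleftrightarrow> (\<exists>\<theta>\<in>carrier SL. \<theta> *v x = y)"

lemma SL_equivalent_refl: "SL_equivalent x x"
  unfolding SL_equivalent_def by (intro bexI[of _ "mat 1"]) (auto simp: carrier_SL_iff)

lemma SL_equivalent_trans:
  assumes "SL_equivalent x y" "SL_equivalent y z"
  shows "SL_equivalent x z"
proof -
  obtain \<theta> \<theta>' where "det \<theta> = 1" "\<theta> *v x = y" "det \<theta>' = 1" "\<theta>' *v y = z"
    using assms unfolding SL_equivalent_def by (auto simp: carrier_SL_iff)
  then show ?thesis
    unfolding SL_equivalent_def
    by (intro bexI[of _ "\<theta>' ** \<theta>"])
      (auto simp: carrier_SL_iff det_mul simp flip: matrix_vector_mul_assoc)
qed

lemma SL_equivalent_change_coordinate: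
  fixes x :: "('p::prime_card, 'd::finite) Fvec"
  assumes "i \<noteq> j" "x $ j \<noteq> 0"
  shows "SL_equivalent x (\<chi> k. if k = i then t else x $ k)"
proof -
  obtain \<theta> where "\<theta> \<in> carrier SL"
    and "\<theta> *v x = (\<chi> k. if k = i then x $ i + ((t - x $ i) / x $ j) * x $ j else x $ k)"
    using transvection_exists[OF assms(1), of "(t - x $ i) / x $ j"] by blast
  moreover have "x $ i + ((t - x $ i) / x $ j) * x $ j = t"
    using assms(2) by simp
  ultimately have "\<theta> *v x = (\<chi> k. if k = i then t else x $ k)"
    by (simp only:)
  with \<open>\<theta> \<in> carrier SL\<close> show ?thesis
    unfolding SL_equivalent_def by blast
qed

text \<open>
  A non-zero coordinate \<open>j\<close> serves as a pivot: transvections with source \<open>j\<close> adjust all other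
  coordinates, one at a time, while leaving the pivot alone.
\<close>

lemma SL_equivalent_common_coordinate:
  fixes x :: "('p::prime_card, 'd::finite) Fvec"
  assumes "x $ j = y $ j" "x $ j \<noteq> 0"
  shows "SL_equivalent x y"
proof -
  have "SL_equivalent x (\<chi> k. if k \<in> S then y $ k else x $ k)" if "j \<notin> S" for S
    using finite[of S] that
  proof (induction S rule: finite_induct)
    case empty
    have "(\<chi> k. if k \<in> {} then y $ k else x $ k) = x"
      by (simp add: vec_eq_iff)
    then show ?case
      by (simp add: SL_equivalent_refl)
  next
    case (insert i S)
    let ?z = "\<chi> k. if k \<in> S then y $ k else x $ k"
    have "SL_equivalent ?z (\<chi> k. if k = i then y $ i else ?z $ k)"
      using insert.prems assms by (intro SL_equivalent_change_coordinate[of i j]) auto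
    moreover have "(\<chi> k. if k = i then y $ i else ?z $ k)
        = (\<chi> k. if k \<in> insert i S then y $ k else x $ k)"
      by (auto simp: vec_eq_iff)
    ultimately show ?case
      using SL_equivalent_trans[OF insert.IH, of "\<chi> k. if k \<in> insert i S then y $ k else x $ k"]
        insert.prems by simp
  qed
  from this[of "- {j}"] have "SL_equivalent x (\<chi> k. if k \<in> - {j} then y $ k else x $ k)"
    by simp
  moreover have "(\<chi> k. if k \<in> - {j} then y $ k else x $ k) = y"
    using assms by (auto simp: vec_eq_iff)
  ultimately show ?thesis
    by simp
qed

text \<open>
  In dimension one, \<open>SL\<close> is trivial.  With a second coordinate at hand, one passes from \<open>x\<close> to \<open>y\<close>
  through a vector that shares one pivot with \<open>x\<close> and a different pivot with \<open>y\<close>; if the pivots of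
  \<open>x\<close> and \<open>y\<close> are at the same place, the all-one vector provides a detour.
\<close>

lemma SL_transitive_nonzero:
  fixes x y :: "('p::prime_card, 'd::finite) Fvec"
  assumes d: "CARD('d) \<ge> 2" and "x \<noteq> 0" "y \<noteq> 0"
  shows "\<exists>\<theta>\<in>carrier SL. \<theta> *v x = y"
proof -
  have link: "SL_equivalent u v" if "u $ i \<noteq> 0" "v $ j \<noteq> 0" "i \<noteq> j"
    for u v :: "('p, 'd) Fvec" and i j
  proof -
    let ?z = "\<chi> k. if k = j then v $ j else u $ k"
    have "SL_equivalent u ?z"
      using that by (intro SL_equivalent_common_coordinate[of u i]) auto
    moreover have "SL_equivalent ?z v"
      using that by (intro SL_equivalent_common_coordinate[of _ j]) auto
    ultimately show ?thesis
      by (rule SL_equivalent_trans)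
  qed
  obtain i j where ij: "x $ i \<noteq> 0" "y $ j \<noteq> 0"
    using assms by (auto simp: vec_eq_iff)
  have "SL_equivalent x y"
  proof (cases "i = j")
    case False
    with ij show ?thesis
      by (intro link[of x i y j])
  next
    case True
    obtain k where k: "k \<noteq> i"
    proof -
      have "card (UNIV :: 'd set) \<noteq> card {i}"
        using d by simp
      then show ?thesis
        using that by (metis UNIV_eq_I singletonI)
    qed
    have "SL_equivalent x (\<chi> m. 1)"
      by (rule link[of x i _ k]) (use ij k in auto)
    moreover have "SL_equivalent (\<chi> m. 1) y"
      by (rule link[of _ k y j]) (use ij k True in auto)
    ultimately show ?thesis
      by (rule SL_equivalent_trans)
  qed
  then show ?thesis
    by (simp add: SL_equivalent_def)
qed

section \<open>The spectral gap on non-zero vectors\<close>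

text \<open>
  The analogue of \<open>theta_operator\<close> for the permutation action of \<open>SL\<close> on vectors in place of its
  action on itself.
\<close>

definition linear_average ::
  "(('p::prime_card, 'd::finite) Fvec \<times> ('p, 'd) Fmat \<Rightarrow> real) \<Rightarrow>
    (('p, 'd) Fvec \<Rightarrow> real) \<Rightarrow> ('p, 'd) Fvec \<Rightarrow> real" where
  "linear_average \<mu> u x = (\<Sum>g\<in>carrier ASL. \<mu> g * u (inv\<^bsub>SL\<^esub> (snd g) *v x))"

lemma L2_norm_on_scale: "L2_norm_on A (\<lambda>x. c * f x) = norm c * L2_norm_on A f"
  for f :: "'a \<Rightarrow> complex"
  by (simp add: L2_norm_on_def norm_mult L2_set_right_distrib)

lemma theta_operator_norm_nonneg: "0 \<le> theta_operator_norm \<mu>"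
  unfolding theta_operator_norm_def L2_op_norm_on_def
  by (rule cSup_upper2[OF _ _ theta_operator_norm_set_bounded,
        of "L2_norm_on (carrier SL) (theta_operator \<mu> (\<lambda>_. 0))"])
    (auto intro!: exI[of _ "\<lambda>_. 0"] sum_nonneg
      simp: L2_norm_on_def orthogonal_to_constants_def L2_set_def)

text \<open>
  The operator norm is a supremum over the unit ball; homogeneity turns it into a bound for every
  function.  A function of norm \<open>0\<close> cannot be normalised and is treated separately.
\<close>

lemma theta_operator_bound:
  fixes \<mu> :: "('p::prime_card, 'd::finite) Fvec \<times> ('p, 'd) Fmat \<Rightarrow> real"
  assumes f: "f \<in> orthogonal_to_constants (carrier SL)"
  shows "L2_norm_on (carrier SL) (theta_operator \<mu> f)
    \<le> theta_operator_norm \<mu> * L2_norm_on (carrier SL) f"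
proof -
  let ?n = "L2_norm_on (carrier (SL :: ('p, 'd) Fmat monoid))"
  have n0: "?n f \<ge> 0"
    by (simp add: L2_norm_on_def)
  show ?thesis
  proof (cases "?n f = 0")
    case True
    then have f0: "f h = 0" if "h \<in> carrier SL" for h
      using that by (simp add: L2_norm_on_def L2_set_eq_0_iff)
    have mem: "inv\<^bsub>SL\<^esub> (snd g) \<otimes>\<^bsub>SL\<^esub> h \<in> carrier SL"
      if "g \<in> carrier ASL" "h \<in> carrier SL" for g :: "('p, 'd) Fvec \<times> ('p, 'd) Fmat" and h
      using that by (intro monoid.m_closed[OF group.is_monoid[OF SL_group]]
            group.inv_closed[OF SL_group]) (auto simp: carrier_ASL_iff)
    have "theta_operator \<mu> f h = 0" if "h \<in> carrier SL" for h
      unfolding theta_operator_def by (intro sum.neutral) (simp add: f0 mem that)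
    then have "?n (theta_operator \<mu> f) = 0"
      by (simp add: L2_norm_on_def L2_set_eq_0_iff)
    then show ?thesis
      using True by (simp add: L2_norm_on_def L2_set_def)
  next
    case False
    let ?c = "complex_of_real (1 / ?n f)"
    have c: "norm ?c = 1 / ?n f"
      using n0 by (simp only: norm_of_real) simp
    have "(\<lambda>x. ?c * f x) \<in> orthogonal_to_constants (carrier SL)"
      using f by (simp add: orthogonal_to_constants_def flip: sum_divide_distrib)
    moreover have "?n (\<lambda>x. ?c * f x) \<le> 1"
      unfolding L2_norm_on_scale c using False by simp
    ultimately have "?n (theta_operator \<mu> (\<lambda>x. ?c * f x)) \<le> theta_operator_norm \<mu>"
      unfolding theta_operator_norm_def L2_op_norm_on_def
      by (intro cSup_upper theta_operator_norm_set_bounded) blast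
    also have "theta_operator \<mu> (\<lambda>x. ?c * f x) = (\<lambda>h. ?c * theta_operator \<mu> f h)"
      by (simp add: theta_operator_def sum_distrib_left mult.left_commute fun_eq_iff)
    finally have "1 / ?n f * ?n (theta_operator \<mu> f) \<le> theta_operator_norm \<mu>"
      unfolding L2_norm_on_scale c .
    then show ?thesis
      using False n0 by (simp add: field_simps)
  qed
qed

text \<open>
  Pulling \<open>u\<close> back along the orbit map \<open>h \<mapsto> h z\<close> gives a function on \<open>SL\<close>, and the pullback
  intertwines \<open>linear_average\<close> with \<open>theta_operator\<close>.
\<close>

lemma SL_gap_on_orbit:
  fixes u :: "('p::prime_card, 'd::finite) Fvec \<Rightarrow> real"
  assumes "(\<Sum>h\<in>carrier SL. u (h *v z)) = 0"
  shows "(\<Sum>h\<in>carrier SL. (linear_average \<mu> u (h *v z))\<^sup>2)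
    \<le> (theta_operator_norm \<mu>)\<^sup>2 * (\<Sum>h\<in>carrier SL. (u (h *v z))\<^sup>2)"
proof -
  let ?f = "\<lambda>h. complex_of_real (u (h *v z))"
  have "(\<Sum>h\<in>carrier SL. ?f h * c) = complex_of_real (\<Sum>h\<in>carrier SL. u (h *v z)) * c" for c
    by (simp add: sum_distrib_right)
  then have "?f \<in> orthogonal_to_constants (carrier SL)"
    using assms by (simp add: orthogonal_to_constants_def)
  from theta_operator_bound[OF this, of \<mu>]
  have "(L2_norm_on (carrier SL) (theta_operator \<mu> ?f))\<^sup>2
      \<le> (theta_operator_norm \<mu> * L2_norm_on (carrier SL) ?f)\<^sup>2"
    by (rule power_mono) (simp add: L2_norm_on_def)
  moreover have "theta_operator \<mu> ?f h = complex_of_real (linear_average \<mu> u (h *v z))" for h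
    by (simp add: theta_operator_def linear_average_def mult_SL matrix_vector_mul_assoc)
  ultimately show ?thesis
    by (simp add: L2_norm_on_def L2_set_def power_mult_distrib sum_nonneg)
qed

lemma sum_SL_translates:
  fixes F :: "('p::prime_card, 'd::finite) Fvec \<Rightarrow> real"
  shows "(\<Sum>z\<in>-{0}. \<Sum>h\<in>carrier SL. F (h *v z))
    = card (carrier (SL :: ('p, 'd) Fmat monoid)) * (\<Sum>x\<in>-{0}. F x)"
proof -
  have "(\<Sum>z\<in>-{0}. \<Sum>h\<in>carrier SL. F (h *v z)) = (\<Sum>h\<in>carrier SL. \<Sum>z\<in>-{0}. F (h *v z))"
    by (rule sum.swap)
  also have "\<dots> = (\<Sum>h\<in>carrier (SL :: ('p, 'd) Fmat monoid). \<Sum>x\<in>-{0}. F x)"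
    by (intro sum.cong refl sum.reindex_bij_betw bij_SL_act_nonzero)
  finally show ?thesis
    by simp
qed

text \<open>
  The spectral gap passes from the regular representation to the functions on non-zero vectors.
  The orbit sums of \<open>u\<close> do not depend on the base point because the action is transitive, so they
  all vanish together with the sum of \<open>u\<close>, and the bound on orbits applies at every base point.
  Summing it over all base points meets every vector equally often; this takes the place of
  counting stabilisers.
\<close>

lemma SL_gap_on_nonzero:
  fixes u :: "('p::prime_card, 'd::finite) Fvec \<Rightarrow> real"
  assumes d: "CARD('d) \<ge> 2" and u: "(\<Sum>x\<in>-{0}. u x) = 0"
  shows "(\<Sum>x\<in>-{0}. (linear_average \<mu> u x)\<^sup>2)
    \<le> (theta_operator_norm \<mu>)\<^sup>2 * (\<Sum>x\<in>-{0}. (u x)\<^sup>2)"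
proof -
  let ?S = "carrier (SL :: ('p, 'd) Fmat monoid)"
  have orbit_const: "(\<Sum>h\<in>?S. u (h *v z)) = (\<Sum>h\<in>?S. u (h *v w))" if zw: "z \<noteq> 0" "w \<noteq> 0" for z w
  proof -
    obtain k where k: "k \<in> ?S" "k *v w = z"
      using SL_transitive_nonzero[OF d zw(2,1)] by blast
    have "bij_betw (\<lambda>h. h \<otimes>\<^bsub>SL\<^esub> k) ?S ?S"
      by (intro bij_betw_byWitness[where f' = "\<lambda>h. h \<otimes>\<^bsub>SL\<^esub> inv\<^bsub>SL\<^esub> k"])
        (auto simp: k group.inv_closed[OF SL_group] monoid.m_assoc[OF group.is_monoid[OF SL_group]]
          group.r_inv[OF SL_group] group.l_inv[OF SL_group]
          monoid.r_one[OF group.is_monoid[OF SL_group]]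
          intro!: monoid.m_closed[OF group.is_monoid[OF SL_group]])
    from sum.reindex_bij_betw[OF this, of "\<lambda>h. u (h *v w)"] show ?thesis
      by (simp add: mult_SL k flip: matrix_vector_mul_assoc)
  qed
  have zero: "(\<Sum>h\<in>?S. u (h *v z)) = 0" if z: "z \<noteq> 0" for z
  proof -
    have "0 = (\<Sum>w\<in>-{0}. \<Sum>h\<in>?S. u (h *v w))"
      using u by (simp add: sum_SL_translates)
    also have "\<dots> = (\<Sum>w\<in>-{0::('p, 'd) Fvec}. \<Sum>h\<in>?S. u (h *v z))"
      using z by (intro sum.cong refl orbit_const) auto
    finally show ?thesis
      using z by auto
  qed
  have "card ?S * (\<Sum>x\<in>-{0}. (linear_average \<mu> u x)\<^sup>2)
      = (\<Sum>z\<in>-{0}. \<Sum>h\<in>?S. (linear_average \<mu> u (h *v z))\<^sup>2)"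
    by (rule sum_SL_translates[symmetric])
  also have "\<dots> \<le> (\<Sum>z\<in>-{0}. (theta_operator_norm \<mu>)\<^sup>2 * (\<Sum>h\<in>?S. (u (h *v z))\<^sup>2))"
    by (intro sum_mono SL_gap_on_orbit zero) auto
  also have "\<dots> = card ?S * ((theta_operator_norm \<mu>)\<^sup>2 * (\<Sum>x\<in>-{0}. (u x)\<^sup>2))"
    by (simp add: sum_SL_translates[of "\<lambda>x. (u x)\<^sup>2"] flip: sum_distrib_left)
  finally show ?thesis
    using monoid.one_closed[OF group.is_monoid[OF SL_group]]
    by (subst (asm) mult_le_cancel_left_pos) (auto simp: card_gt_0_iff)
qed

section \<open>Averaging along the walk\<close>

text \<open>
  The action of a single group element on functions, so that \<open>measure_act\<close> is an average of
  translates.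
\<close>

definition translate ::
  "('p::prime_card, 'd::finite) Fvec \<times> ('p, 'd) Fmat \<Rightarrow>
    (('p, 'd) Fvec \<Rightarrow> real) \<Rightarrow> ('p, 'd) Fvec \<Rightarrow> real" where
  "translate g f x = f (aff_act (inv\<^bsub>ASL\<^esub> g) x)"

lemma measure_act_eq_translate: "measure_act \<mu> f x = (\<Sum>g\<in>carrier ASL. \<mu> g * translate g f x)"
  by (simp add: measure_act_def translate_def)

lemma sum_translate:
  assumes "g \<in> carrier ASL"
  shows "(\<Sum>x\<in>UNIV. F (translate g f x)) = (\<Sum>x\<in>UNIV. F (f x))"
  unfolding translate_def
  using sum.reindex_bij_betw[OF bij_aff_act[OF group.inv_closed[OF ASL_group assms]],
      of "\<lambda>x. F (f x)"] .

text \<open>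
  Convolution powers act as iterates of one averaging operator, so the walk can be followed one step
  at a time.
\<close>

lemma measure_act_convolution:
  "measure_act (convolution ASL \<mu> \<kappa>) f = measure_act \<mu> (measure_act \<kappa> f)"
    for \<mu> :: "('p::prime_card, 'd::finite) Fvec \<times> ('p, 'd) Fmat \<Rightarrow> real"
proof
  fix x :: "('p, 'd) Fvec"
  interpret ASL: group "ASL :: (('p, 'd) Fvec \<times> ('p, 'd) Fmat) monoid"
    by (rule ASL_group)
  let ?G = "carrier (ASL :: (('p, 'd) Fvec \<times> ('p, 'd) Fmat) monoid)"
  have "(\<Sum>g\<in>?G. \<kappa> (inv\<^bsub>ASL\<^esub> h \<otimes>\<^bsub>ASL\<^esub> g) * f (aff_act (inv\<^bsub>ASL\<^esub> g) x))
      = (\<Sum>k\<in>?G. \<kappa> k * f (aff_act (inv\<^bsub>ASL\<^esub> k) (aff_act (inv\<^bsub>ASL\<^esub> h) x)))" if h: "h \<in> ?G" for h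
  proof (rule sum.reindex_bij_witness[where i = "\<lambda>k. h \<otimes>\<^bsub>ASL\<^esub> k" and j = "\<lambda>g. inv\<^bsub>ASL\<^esub> h \<otimes>\<^bsub>ASL\<^esub> g"])
    fix g assume g: "g \<in> ?G"
    show "h \<otimes>\<^bsub>ASL\<^esub> (inv\<^bsub>ASL\<^esub> h \<otimes>\<^bsub>ASL\<^esub> g) = g" "inv\<^bsub>ASL\<^esub> h \<otimes>\<^bsub>ASL\<^esub> (h \<otimes>\<^bsub>ASL\<^esub> g) = g"
      using g h by (simp_all flip: ASL.m_assoc)
    show "inv\<^bsub>ASL\<^esub> h \<otimes>\<^bsub>ASL\<^esub> g \<in> ?G" "h \<otimes>\<^bsub>ASL\<^esub> g \<in> ?G"
      using g h by simp_all
    have "inv\<^bsub>ASL\<^esub> (inv\<^bsub>ASL\<^esub> h \<otimes>\<^bsub>ASL\<^esub> g) \<otimes>\<^bsub>ASL\<^esub> inv\<^bsub>ASL\<^esub> h = inv\<^bsub>ASL\<^esub> g"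
      using g h by (simp add: ASL.inv_mult_group ASL.m_assoc)
    then show "\<kappa> (inv\<^bsub>ASL\<^esub> h \<otimes>\<^bsub>ASL\<^esub> g)
        * f (aff_act (inv\<^bsub>ASL\<^esub> (inv\<^bsub>ASL\<^esub> h \<otimes>\<^bsub>ASL\<^esub> g)) (aff_act (inv\<^bsub>ASL\<^esub> h) x))
      = \<kappa> (inv\<^bsub>ASL\<^esub> h \<otimes>\<^bsub>ASL\<^esub> g) * f (aff_act (inv\<^bsub>ASL\<^esub> g) x)"
      by (simp flip: aff_act_mult)
  qed
  then have "(\<Sum>h\<in>?G. \<mu> h * (\<Sum>g\<in>?G. \<kappa> (inv\<^bsub>ASL\<^esub> h \<otimes>\<^bsub>ASL\<^esub> g) * f (aff_act (inv\<^bsub>ASL\<^esub> g) x)))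
      = measure_act \<mu> (measure_act \<kappa> f) x"
    by (simp add: measure_act_def)
  moreover have "measure_act (convolution ASL \<mu> \<kappa>) f x
      = (\<Sum>g\<in>?G. \<Sum>h\<in>?G. \<mu> h * (\<kappa> (inv\<^bsub>ASL\<^esub> h \<otimes>\<^bsub>ASL\<^esub> g) * f (aff_act (inv\<^bsub>ASL\<^esub> g) x)))"
    by (simp add: measure_act_def convolution_def sum_distrib_right mult.assoc)
  then have "measure_act (convolution ASL \<mu> \<kappa>) f x
      = (\<Sum>h\<in>?G. \<mu> h * (\<Sum>g\<in>?G. \<kappa> (inv\<^bsub>ASL\<^esub> h \<otimes>\<^bsub>ASL\<^esub> g) * f (aff_act (inv\<^bsub>ASL\<^esub> g) x)))"
    by (subst (asm) sum.swap) (simp add: sum_distrib_left)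
  ultimately show "measure_act (convolution ASL \<mu> \<kappa>) f x = measure_act \<mu> (measure_act \<kappa> f) x"
    by simp
qed

lemma measure_act_point_mass_one: "measure_act (point_mass \<one>\<^bsub>ASL\<^esub>) f = f"
proof
  fix x
  have "measure_act (point_mass \<one>\<^bsub>ASL\<^esub>) f x
      = (\<Sum>g\<in>carrier ASL. if g = \<one>\<^bsub>ASL\<^esub> then f (aff_act (inv\<^bsub>ASL\<^esub> g) x) else 0)"
    by (simp add: measure_act_def point_mass_def if_distrib[of "\<lambda>t. t * _"] cong: if_cong)
  also have "\<dots> = f x"
    by (simp add: sum.delta monoid.one_closed[OF group.is_monoid[OF ASL_group]]
        monoid.inv_one[OF group.is_monoid[OF ASL_group]] aff_act_one)
  finally show "measure_act (point_mass \<one>\<^bsub>ASL\<^esub>) f x = f x" .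
qed

lemma measure_act_nonneg:
  assumes "prob_measure_on (carrier ASL) \<mu>" "\<And>x. 0 \<le> f x"
  shows "0 \<le> measure_act \<mu> f x"
  using assms unfolding measure_act_def prob_measure_on_def
  by (intro sum_nonneg mult_nonneg_nonneg) auto

lemma sum_measure_act:
  assumes "prob_measure_on (carrier ASL) \<mu>"
  shows "(\<Sum>x\<in>UNIV. measure_act \<mu> f x) = (\<Sum>x\<in>UNIV. f x)"
proof -
  have "(\<Sum>x\<in>UNIV. measure_act \<mu> f x)
      = (\<Sum>g\<in>carrier ASL. \<mu> g * (\<Sum>x\<in>UNIV. translate g f x))"
    unfolding measure_act_eq_translate by (subst sum.swap) (simp add: sum_distrib_left)
  also have "\<dots> = (\<Sum>g\<in>carrier ASL. \<mu> g) * (\<Sum>x\<in>UNIV. f x)"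
    using sum_translate[of _ "\<lambda>t. t" f] by (simp add: sum_distrib_right)
  finally show ?thesis
    using assms by (simp add: prob_measure_on_def)
qed

text \<open>
  Twice the variance of \<open>a\<close> as the mean square difference of two independent samples.  Applied to
  vectors of equal length it says that an average which is almost as long as the vectors averaged
  forces these to be close to each other in mean square.
\<close>

lemma pair_variance:
  fixes \<mu> a :: "'g \<Rightarrow> real"
  assumes "(\<Sum>g\<in>G. \<mu> g) = 1"
  shows "(\<Sum>g\<in>G. \<Sum>h\<in>G. \<mu> g * \<mu> h * (a g - a h)\<^sup>2)
    = 2 * (\<Sum>g\<in>G. \<mu> g * (a g)\<^sup>2) - 2 * (\<Sum>g\<in>G. \<mu> g * a g)\<^sup>2"
proof -
  have "\<mu> g * \<mu> h * (a g - a h)\<^sup>2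
      = (\<mu> g * (a g)\<^sup>2) * \<mu> h + \<mu> g * (\<mu> h * (a h)\<^sup>2) - 2 * ((\<mu> g * a g) * (\<mu> h * a h))" for g h
    by (simp add: power2_eq_square algebra_simps)
  then have "(\<Sum>g\<in>G. \<Sum>h\<in>G. \<mu> g * \<mu> h * (a g - a h)\<^sup>2)
      = (\<Sum>g\<in>G. \<mu> g * (a g)\<^sup>2) * (\<Sum>h\<in>G. \<mu> h) + (\<Sum>g\<in>G. \<mu> g) * (\<Sum>h\<in>G. \<mu> h * (a h)\<^sup>2)
        - 2 * ((\<Sum>g\<in>G. \<mu> g * a g) * (\<Sum>h\<in>G. \<mu> h * a h))"
    by (simp only: sum.distrib sum_subtractf sum_product) (simp only: sum_distrib_left)
  then show ?thesis
    using assms by (simp add: power2_eq_square)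
qed

lemma pair_variance_functions:
  fixes \<mu> :: "'g \<Rightarrow> real" and w :: "'g \<Rightarrow> 'x \<Rightarrow> real"
  assumes "(\<Sum>g\<in>G. \<mu> g) = 1"
  shows "(\<Sum>g\<in>G. \<Sum>h\<in>G. \<mu> g * \<mu> h * (\<Sum>x\<in>X. (w g x - w h x)\<^sup>2))
    = 2 * (\<Sum>g\<in>G. \<mu> g * (\<Sum>x\<in>X. (w g x)\<^sup>2)) - 2 * (\<Sum>x\<in>X. (\<Sum>g\<in>G. \<mu> g * w g x)\<^sup>2)"
proof -
  have "(\<Sum>g\<in>G. \<Sum>h\<in>G. \<mu> g * \<mu> h * (\<Sum>x\<in>X. (w g x - w h x)\<^sup>2))
      = (\<Sum>g\<in>G. \<Sum>x\<in>X. \<Sum>h\<in>G. \<mu> g * \<mu> h * (w g x - w h x)\<^sup>2)"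
    by (simp add: sum_distrib_left sum.swap[of _ X])
  also have "\<dots> = (\<Sum>x\<in>X. \<Sum>g\<in>G. \<Sum>h\<in>G. \<mu> g * \<mu> h * (w g x - w h x)\<^sup>2)"
    by (rule sum.swap)
  also have "\<dots> = 2 * (\<Sum>x\<in>X. \<Sum>g\<in>G. \<mu> g * (w g x)\<^sup>2) - 2 * (\<Sum>x\<in>X. (\<Sum>g\<in>G. \<mu> g * w g x)\<^sup>2)"
    by (simp add: pair_variance[OF assms] sum_subtractf sum_distrib_left)
  also have "(\<Sum>x\<in>X. \<Sum>g\<in>G. \<mu> g * (w g x)\<^sup>2) = (\<Sum>g\<in>G. \<mu> g * (\<Sum>x\<in>X. (w g x)\<^sup>2))"
    by (subst sum.swap) (simp add: sum_distrib_left)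
  finally show ?thesis .
qed

lemma measure_act_pair_variance:
  fixes \<phi> :: "('p::prime_card, 'd::finite) Fvec \<Rightarrow> real"
  assumes "prob_measure_on (carrier ASL) \<mu>"
  shows "(\<Sum>g\<in>carrier ASL. \<Sum>h\<in>carrier ASL.
      \<mu> g * \<mu> h * (\<Sum>x\<in>UNIV. (translate g \<phi> x - translate h \<phi> x)\<^sup>2))
    = 2 * (\<Sum>x\<in>UNIV. (\<phi> x)\<^sup>2) - 2 * (\<Sum>x\<in>UNIV. (measure_act \<mu> \<phi> x)\<^sup>2)"
proof -
  have \<mu>: "(\<Sum>g\<in>carrier ASL. \<mu> g) = 1"
    using assms by (simp add: prob_measure_on_def)
  have "(\<Sum>g\<in>carrier ASL. \<mu> g * (\<Sum>x\<in>UNIV. (translate g \<phi> x)\<^sup>2))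
      = (\<Sum>g\<in>carrier ASL. \<mu> g) * (\<Sum>x\<in>UNIV. (\<phi> x)\<^sup>2)"
    using sum_translate[of _ "\<lambda>t. t\<^sup>2" \<phi>] by (simp add: sum_distrib_right)
  then show ?thesis
    by (simp add: pair_variance_functions[OF \<mu>] measure_act_eq_translate \<mu>)
qed

text \<open>
  The defect \<open>\<parallel>\<phi>\<parallel>\<^sup>2 - \<parallel>\<mu>.\<phi>\<parallel>\<^sup>2\<close> is half a mean square distance, hence not negative.
\<close>

lemma measure_act_L2_contraction:
  fixes \<phi> :: "('p::prime_card, 'd::finite) Fvec \<Rightarrow> real"
  assumes "prob_measure_on (carrier ASL) \<mu>"
  shows "(\<Sum>x\<in>UNIV. (measure_act \<mu> \<phi> x)\<^sup>2) \<le> (\<Sum>x\<in>UNIV. (\<phi> x)\<^sup>2)"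
proof -
  have "0 \<le> (\<Sum>g\<in>carrier ASL. \<Sum>h\<in>carrier ASL.
      \<mu> g * \<mu> h * (\<Sum>x\<in>UNIV. (translate g \<phi> x - translate h \<phi> x)\<^sup>2))"
    using assms unfolding prob_measure_on_def
    by (intro sum_nonneg mult_nonneg_nonneg) auto
  then show ?thesis
    by (simp add: measure_act_pair_variance[OF assms])
qed

lemma linear_average_pair_variance:
  fixes u :: "('p::prime_card, 'd::finite) Fvec \<Rightarrow> real"
  assumes "prob_measure_on (carrier ASL) \<mu>"
  shows "(\<Sum>g\<in>carrier ASL. \<Sum>h\<in>carrier ASL.
      \<mu> g * \<mu> h * (\<Sum>x\<in>UNIV. (u (inv\<^bsub>SL\<^esub> (snd g) *v x) - u (inv\<^bsub>SL\<^esub> (snd h) *v x))\<^sup>2))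
    = 2 * (\<Sum>x\<in>UNIV. (u x)\<^sup>2) - 2 * (\<Sum>x\<in>UNIV. (linear_average \<mu> u x)\<^sup>2)"
proof -
  have \<mu>: "(\<Sum>g\<in>carrier ASL. \<mu> g) = 1"
    using assms by (simp add: prob_measure_on_def)
  have "(\<Sum>x\<in>UNIV. (u (inv\<^bsub>SL\<^esub> (snd g) *v x))\<^sup>2) = (\<Sum>x\<in>UNIV. (u x)\<^sup>2)"
    if "g \<in> carrier ASL" for g
    using that by (intro sum.reindex_bij_betw bij_SL_act group.inv_closed[OF SL_group])
      (simp add: carrier_ASL_iff)
  then have "(\<Sum>g\<in>carrier ASL. \<mu> g * (\<Sum>x\<in>UNIV. (u (inv\<^bsub>SL\<^esub> (snd g) *v x))\<^sup>2))
      = (\<Sum>g\<in>carrier ASL. \<mu> g) * (\<Sum>x\<in>UNIV. (u x)\<^sup>2)"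
    by (simp add: sum_distrib_right)
  then show ?thesis
    by (simp add: pair_variance_functions[OF \<mu>] linear_average_def \<mu>)
qed

lemma sum_split_zero: "(\<Sum>x\<in>UNIV. f x) = f 0 + (\<Sum>x\<in>-{0}. f x)"
  for f :: "'a::{finite, zero} \<Rightarrow> real"
  using sum.remove[of UNIV 0 f] by (simp add: Compl_eq_Diff_UNIV)

lemma sum_square_shift:
  fixes \<beta> :: real
  shows "(\<Sum>x\<in>X. (\<beta> + v x)\<^sup>2) = card X * \<beta>\<^sup>2 + 2 * \<beta> * (\<Sum>x\<in>X. v x) + (\<Sum>x\<in>X. (v x)\<^sup>2)"
  by (simp add: power2_sum sum.distrib sum_distrib_left mult.assoc)

lemma nonzero_vectors_nonempty: "- {0 :: 'a::zero_neq_one ^ 'n} \<noteq> {}"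
proof -
  have "(\<chi> i. 1) \<in> - {0 :: 'a ^ 'n}"
    by (simp add: vec_eq_iff)
  then show ?thesis
    by blast
qed

text \<open>
  On the non-zero vectors \<open>B\<close> splits into its mean, which the linear parts preserve, and a part of
  mean zero, which the average shrinks by the operator norm.  The value at the fixed point \<open>0\<close> is
  preserved as well.
\<close>

lemma linear_average_energy:
  fixes B :: "('p::prime_card, 'd::finite) Fvec \<Rightarrow> real"
  assumes d: "CARD('d) \<ge> 2" and prob: "prob_measure_on (carrier ASL) \<mu>"
    and \<beta>: "\<beta> = (\<Sum>x\<in>-{0}. B x) / card (-{0::('p, 'd) Fvec})"
  shows "(\<Sum>x\<in>UNIV. (linear_average \<mu> B x)\<^sup>2)
    \<le> (\<Sum>x\<in>UNIV. (B x)\<^sup>2) - (1 - (theta_operator_norm \<mu>)\<^sup>2) * (\<Sum>x\<in>-{0}. (B x - \<beta>)\<^sup>2)"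
proof -
  have \<mu>: "(\<Sum>g\<in>carrier ASL. \<mu> g) = 1"
    using prob by (simp add: prob_measure_on_def)
  define u where "u x = B x - \<beta>" for x
  let ?N = "card (-{0::('p, 'd) Fvec})"
  have u0: "(\<Sum>x\<in>-{0}. u x) = 0"
    by (simp add: u_def sum_subtractf \<beta> nonzero_vectors_nonempty)
  have avg: "linear_average \<mu> B x = \<beta> + linear_average \<mu> u x" for x
    by (simp add: linear_average_def u_def right_diff_distrib sum_subtractf \<mu>
        flip: sum_distrib_right)
  have avg_0: "linear_average \<mu> B 0 = B 0"
    by (simp add: linear_average_def \<mu> flip: sum_distrib_right)
  have "(\<Sum>x\<in>-{0}. u (inv\<^bsub>SL\<^esub> (snd g) *v x)) = 0" if "g \<in> carrier ASL" for g
    using that u0 sum.reindex_bij_betw[OF bij_SL_act_nonzero[of "inv\<^bsub>SL\<^esub> (snd g)"], of u]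
    by (simp add: carrier_ASL_iff group.inv_closed[OF SL_group])
  then have "(\<Sum>x\<in>-{0}. linear_average \<mu> u x) = 0"
    unfolding linear_average_def by (subst sum.swap) (simp flip: sum_distrib_left)
  then have "(\<Sum>x\<in>-{0}. (linear_average \<mu> B x)\<^sup>2)
      = ?N * \<beta>\<^sup>2 + (\<Sum>x\<in>-{0}. (linear_average \<mu> u x)\<^sup>2)"
    by (simp add: avg sum_square_shift)
  also have "\<dots> \<le> ?N * \<beta>\<^sup>2 + (theta_operator_norm \<mu>)\<^sup>2 * (\<Sum>x\<in>-{0}. (u x)\<^sup>2)"
    using SL_gap_on_nonzero[OF d u0] by simp
  finally have A: "(\<Sum>x\<in>-{0}. (linear_average \<mu> B x)\<^sup>2)
      \<le> ?N * \<beta>\<^sup>2 + (theta_operator_norm \<mu>)\<^sup>2 * (\<Sum>x\<in>-{0}. (u x)\<^sup>2)" .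
  have "(\<Sum>x\<in>-{0}. (B x)\<^sup>2) = (\<Sum>x\<in>-{0}. (\<beta> + u x)\<^sup>2)"
    by (simp add: u_def)
  also have "\<dots> = ?N * \<beta>\<^sup>2 + (\<Sum>x\<in>-{0}. (u x)\<^sup>2)"
    by (simp add: sum_square_shift u0)
  finally show ?thesis
    using A by (simp add: sum_split_zero avg_0 u_def algebra_simps)
qed

section \<open>Autocorrelations\<close>

text \<open>
  The law of the difference of two independent samples of \<open>\<nu>\<close>.  Differences do not see
  translations, so on autocorrelations the affine group acts through its linear part only, and the
  spectral gap of the linear part becomes applicable.
\<close>

definition autocorrelation :: "('a::{finite, ab_group_add} \<Rightarrow> real) \<Rightarrow> 'a \<Rightarrow> real" where
  "autocorrelation \<nu> x = (\<Sum>y\<in>UNIV. \<nu> y * \<nu> (y + x))"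

lemma sum_shift:
  fixes f :: "'a::{finite, ab_group_add} \<Rightarrow> real"
  shows "(\<Sum>x\<in>UNIV. f (y + x)) = (\<Sum>x\<in>UNIV. f x)"
  by (rule sum.reindex_bij_witness[where i = "\<lambda>x. x - y" and j = "\<lambda>x. y + x"]) auto

lemma autocorrelation_nonneg: "(\<And>x. 0 \<le> \<nu> x) \<Longrightarrow> 0 \<le> autocorrelation \<nu> x"
  by (simp add: autocorrelation_def sum_nonneg)

lemma autocorrelation_zero: "autocorrelation \<nu> 0 = (\<Sum>x\<in>UNIV. (\<nu> x)\<^sup>2)"
  by (simp add: autocorrelation_def power2_eq_square)

lemma sum_autocorrelation: "(\<Sum>x\<in>UNIV. autocorrelation \<nu> x) = (\<Sum>x\<in>UNIV. \<nu> x)\<^sup>2"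
proof -
  have "(\<Sum>x\<in>UNIV. autocorrelation \<nu> x) = (\<Sum>y\<in>UNIV. \<nu> y * (\<Sum>x\<in>UNIV. \<nu> (y + x)))"
    unfolding autocorrelation_def by (subst sum.swap) (simp add: sum_distrib_left)
  then show ?thesis
    by (simp add: sum_shift[of \<nu>] power2_eq_square flip: sum_distrib_right)
qed

lemma autocorrelation_translate:
  fixes \<nu> :: "('p::prime_card, 'd::finite) Fvec \<Rightarrow> real"
  assumes g: "g \<in> carrier ASL"
  shows "autocorrelation (translate g \<nu>) x = autocorrelation \<nu> (inv\<^bsub>SL\<^esub> (snd g) *v x)"
proof -
  let ?h = "inv\<^bsub>ASL\<^esub> g"
  have "autocorrelation (translate g \<nu>) x
      = (\<Sum>y\<in>UNIV. \<nu> (aff_act ?h y) * \<nu> (aff_act ?h y + snd ?h *v x))"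
    by (simp add: autocorrelation_def translate_def aff_act_add)
  also have "\<dots> = autocorrelation \<nu> (snd ?h *v x)"
    unfolding autocorrelation_def
    using sum.reindex_bij_betw[OF bij_aff_act[OF group.inv_closed[OF ASL_group g]],
        of "\<lambda>y. \<nu> y * \<nu> (y + snd ?h *v x)"] .
  finally show ?thesis
    by (simp add: snd_inv_ASL g)
qed

text \<open>
  Exchange the two factors \<open>\<nu> y\<close> and \<open>\<nu> (y + x)\<close> for those of \<open>\<nu>'\<close> one after the other.
\<close>

lemma autocorrelation_L1_Lipschitz:
  fixes \<nu> \<nu>' :: "'a::{finite, ab_group_add} \<Rightarrow> real"
  assumes "\<And>x. 0 \<le> \<nu> x" "\<And>x. 0 \<le> \<nu>' x"
  shows "(\<Sum>x\<in>UNIV. \<bar>autocorrelation \<nu> x - autocorrelation \<nu>' x\<bar>)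
    \<le> ((\<Sum>x\<in>UNIV. \<nu> x) + (\<Sum>x\<in>UNIV. \<nu>' x)) * (\<Sum>x\<in>UNIV. \<bar>\<nu> x - \<nu>' x\<bar>)"
proof -
  let ?D = "\<lambda>x. \<bar>\<nu> x - \<nu>' x\<bar>"
  have "\<bar>autocorrelation \<nu> x - autocorrelation \<nu>' x\<bar>
      \<le> (\<Sum>y\<in>UNIV. ?D y * \<nu> (y + x) + \<nu>' y * ?D (y + x))" for x
  proof -
    have "\<bar>\<nu> y * \<nu> (y + x) - \<nu>' y * \<nu>' (y + x)\<bar> \<le> ?D y * \<nu> (y + x) + \<nu>' y * ?D (y + x)" for y
    proof -
      have "\<nu> y * \<nu> (y + x) - \<nu>' y * \<nu>' (y + x)
          = (\<nu> y - \<nu>' y) * \<nu> (y + x) + \<nu>' y * (\<nu> (y + x) - \<nu>' (y + x))"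
        by (simp add: algebra_simps)
      also have "\<bar>\<dots>\<bar> \<le> \<bar>(\<nu> y - \<nu>' y) * \<nu> (y + x)\<bar> + \<bar>\<nu>' y * (\<nu> (y + x) - \<nu>' (y + x))\<bar>"
        by (rule abs_triangle_ineq)
      finally show ?thesis
        using assms by (simp add: abs_mult)
    qed
    then show ?thesis
      unfolding autocorrelation_def sum_subtractf[symmetric]
      by (intro order_trans[OF sum_abs] sum_mono)
  qed
  then have "(\<Sum>x\<in>UNIV. \<bar>autocorrelation \<nu> x - autocorrelation \<nu>' x\<bar>)
      \<le> (\<Sum>x\<in>UNIV. \<Sum>y\<in>UNIV. ?D y * \<nu> (y + x) + \<nu>' y * ?D (y + x))"
    by (rule sum_mono)
  also have "\<dots> = (\<Sum>y\<in>UNIV. \<Sum>x\<in>UNIV. ?D y * \<nu> (y + x) + \<nu>' y * ?D (y + x))"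
    by (rule sum.swap)
  also have "\<dots> = (\<Sum>y\<in>UNIV. ?D y * (\<Sum>x\<in>UNIV. \<nu> x) + \<nu>' y * (\<Sum>x\<in>UNIV. ?D x))"
    by (simp add: sum.distrib sum_shift[of \<nu>] sum_shift[of ?D] flip: sum_distrib_left)
  also have "\<dots> = ((\<Sum>x\<in>UNIV. \<nu> x) + (\<Sum>x\<in>UNIV. \<nu>' x)) * (\<Sum>x\<in>UNIV. ?D x)"
    by (simp only: sum.distrib sum_distrib_right[symmetric]) (simp add: algebra_simps)
  finally show ?thesis .
qed

text \<open>
  Square roots turn densities that are close in \<open>L\<^sup>1\<close> into functions that are close in \<open>L\<^sup>2\<close>, which is
  where the spectral gap is stated.
\<close>

lemma square_diff_sqrt_le: "(sqrt a - sqrt b)\<^sup>2 \<le> \<bar>a - b\<bar>" if "0 \<le> a" "0 \<le> b"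
proof -
  have "(sqrt a - sqrt b)\<^sup>2 = \<bar>sqrt a - sqrt b\<bar> * \<bar>sqrt a - sqrt b\<bar>"
    by (simp add: power2_eq_square)
  also have "\<dots> \<le> \<bar>sqrt a - sqrt b\<bar> * \<bar>sqrt a + sqrt b\<bar>"
    using that by (intro mult_left_mono) (auto simp: abs_le_iff)
  also have "\<dots> = \<bar>(sqrt a - sqrt b) * (sqrt a + sqrt b)\<bar>"
    by (rule abs_mult[symmetric])
  also have "(sqrt a - sqrt b) * (sqrt a + sqrt b) = a - b"
    using that by (simp add: algebra_simps)
  finally show ?thesis .
qed

text \<open>
  The square root of the autocorrelation of \<open>\<phi>\<^sup>2\<close> at \<open>x\<close> is the Euclidean norm of the family
  \<open>\<phi> y \<phi> (y + x)\<close>, which is at most its \<open>L\<^sup>1\<close> norm.  A function with small \<open>L\<^sup>1\<close> norm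
  thus has an autocorrelation that cannot be spread out: a flat density of mass \<open>m\<close> on
  \<open>N\<close> points has a square root of sum \<open>sqrt (m * N)\<close>.
\<close>

lemma sum_sqrt_autocorrelation_le:
  fixes \<phi> :: "'a::{finite, ab_group_add} \<Rightarrow> real"
  assumes "\<And>x. 0 \<le> \<phi> x"
  shows "(\<Sum>x\<in>UNIV. sqrt (autocorrelation (\<lambda>y. (\<phi> y)\<^sup>2) x)) \<le> (\<Sum>x\<in>UNIV. \<phi> x)\<^sup>2"
proof -
  have "sqrt (autocorrelation (\<lambda>y. (\<phi> y)\<^sup>2) x) \<le> autocorrelation \<phi> x" for x
    using L2_set_le_sum[of UNIV "\<lambda>y. \<phi> y * \<phi> (y + x)"] assms
    by (simp add: autocorrelation_def L2_set_def power_mult_distrib)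
  then have "(\<Sum>x\<in>UNIV. sqrt (autocorrelation (\<lambda>y. (\<phi> y)\<^sup>2) x)) \<le> (\<Sum>x\<in>UNIV. autocorrelation \<phi> x)"
    by (rule sum_mono)
  then show ?thesis
    by (simp add: sum_autocorrelation)
qed

text \<open>
  The inequality between the arithmetic and the geometric mean, applied with weight \<open>s\<close> to the
  product \<open>\<bar>a - b\<bar> * \<bar>a + b\<bar>\<close> at each point.  Unlike the bound by Cauchy--Schwarz, this one is
  affine in the square of the \<open>L\<^sup>2\<close> distance and can be averaged over pairs of group elements as
  it is.
\<close>

lemma L1_dist_squares_le:
  fixes a b :: "'x \<Rightarrow> real"
  assumes a: "(\<Sum>x\<in>X. (a x)\<^sup>2) = 1" and b: "(\<Sum>x\<in>X. (b x)\<^sup>2) = 1" and s: "s > 0"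
  shows "(\<Sum>x\<in>X. \<bar>(a x)\<^sup>2 - (b x)\<^sup>2\<bar>) \<le> s * (\<Sum>x\<in>X. (a x - b x)\<^sup>2) + 1 / s"
proof -
  have "\<bar>(a x)\<^sup>2 - (b x)\<^sup>2\<bar> \<le> s * (a x - b x)\<^sup>2 + (1 / s) * (((a x)\<^sup>2 + (b x)\<^sup>2) / 2)" for x
  proof -
    have "\<bar>(a x)\<^sup>2 - (b x)\<^sup>2\<bar> = \<bar>a x - b x\<bar> * \<bar>a x + b x\<bar>"
      by (simp add: power2_eq_square algebra_simps flip: abs_mult)
    moreover have "0 \<le> (s * \<bar>a x - b x\<bar> - \<bar>a x + b x\<bar> / 2)\<^sup>2 / s"
      using s by simp
    moreover have "(s * \<bar>a x - b x\<bar> - \<bar>a x + b x\<bar> / 2)\<^sup>2 / s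
        = s * (a x - b x)\<^sup>2 - \<bar>a x - b x\<bar> * \<bar>a x + b x\<bar> + (1 / s) * ((a x + b x)\<^sup>2 / 4)"
      using s by (simp add: power2_diff power_mult_distrib power_divide field_simps power2_eq_square)
    moreover have "(1 / s) * ((a x + b x)\<^sup>2 / 4) \<le> (1 / s) * (((a x)\<^sup>2 + (b x)\<^sup>2) / 2)"
      using s sum_squares_ge_zero[of "a x - b x" 0]
      by (intro mult_left_mono) (auto simp: power2_eq_square algebra_simps)
    ultimately show ?thesis
      by linarith
  qed
  then have "(\<Sum>x\<in>X. \<bar>(a x)\<^sup>2 - (b x)\<^sup>2\<bar>)
      \<le> (\<Sum>x\<in>X. s * (a x - b x)\<^sup>2 + (1 / s) * (((a x)\<^sup>2 + (b x)\<^sup>2) / 2))"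
    by (rule sum_mono)
  also have "\<dots> = s * (\<Sum>x\<in>X. (a x - b x)\<^sup>2) + (1 / s) * (((\<Sum>x\<in>X. (a x)\<^sup>2) + (\<Sum>x\<in>X. (b x)\<^sup>2)) / 2)"
    by (simp add: sum.distrib add_divide_distrib flip: sum_distrib_left sum_divide_distrib)
  finally show ?thesis
    by (simp add: a b)
qed

text \<open>
  Two translates of \<open>\<phi>\<close> that are close in \<open>L\<^sup>2\<close> have squares that are close in \<open>L\<^sup>1\<close>, hence
  autocorrelations of squares that are close in \<open>L\<^sup>1\<close>, and the square roots of these are close in
  \<open>L\<^sup>2\<close> again.  These square roots arise from \<open>B\<close> by the linear parts of the two group elements.
\<close>

lemma sqrt_autocorrelation_displacement:
  fixes \<phi> :: "('p::prime_card, 'd::finite) Fvec \<Rightarrow> real"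
  assumes \<phi>: "(\<Sum>x\<in>UNIV. (\<phi> x)\<^sup>2) = 1" and gh: "g \<in> carrier ASL" "h \<in> carrier ASL" and s: "s > 0"
  defines "B \<equiv> \<lambda>x. sqrt (autocorrelation (\<lambda>y. (\<phi> y)\<^sup>2) x)"
  shows "(\<Sum>x\<in>UNIV. (B (inv\<^bsub>SL\<^esub> (snd g) *v x) - B (inv\<^bsub>SL\<^esub> (snd h) *v x))\<^sup>2)
    \<le> 2 * (s * (\<Sum>x\<in>UNIV. (translate g \<phi> x - translate h \<phi> x)\<^sup>2) + 1 / s)"
proof -
  let ?\<nu> = "\<lambda>g x. (translate g \<phi> x)\<^sup>2"
  have norm1: "(\<Sum>x\<in>UNIV. ?\<nu> k x) = 1" if "k \<in> carrier ASL" for k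
    using sum_translate[OF that, of "\<lambda>t. t\<^sup>2" \<phi>] \<phi> by simp
  have B: "B (inv\<^bsub>SL\<^esub> (snd k) *v x) = sqrt (autocorrelation (?\<nu> k) x)" if "k \<in> carrier ASL" for k x
  proof -
    have "?\<nu> k = translate k (\<lambda>y. (\<phi> y)\<^sup>2)"
      by (simp add: translate_def fun_eq_iff)
    then show ?thesis
      by (simp add: B_def autocorrelation_translate that)
  qed
  have "(\<Sum>x\<in>UNIV. (B (inv\<^bsub>SL\<^esub> (snd g) *v x) - B (inv\<^bsub>SL\<^esub> (snd h) *v x))\<^sup>2)
      \<le> (\<Sum>x\<in>UNIV. \<bar>autocorrelation (?\<nu> g) x - autocorrelation (?\<nu> h) x\<bar>)"
    by (intro sum_mono) (simp add: B gh square_diff_sqrt_le autocorrelation_nonneg)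
  also have "\<dots> \<le> ((\<Sum>x\<in>UNIV. ?\<nu> g x) + (\<Sum>x\<in>UNIV. ?\<nu> h x)) * (\<Sum>x\<in>UNIV. \<bar>?\<nu> g x - ?\<nu> h x\<bar>)"
    by (rule autocorrelation_L1_Lipschitz) simp_all
  also have "\<dots> = 2 * (\<Sum>x\<in>UNIV. \<bar>?\<nu> g x - ?\<nu> h x\<bar>)"
    by (simp add: norm1 gh)
  also have "\<dots> \<le> 2 * (s * (\<Sum>x\<in>UNIV. (translate g \<phi> x - translate h \<phi> x)\<^sup>2) + 1 / s)"
    by (intro mult_left_mono L1_dist_squares_le norm1 gh s) simp
  finally show ?thesis .
qed

section \<open>Contraction of spread-out densities\<close>

lemma card_vectors_ge_4:
  assumes "CARD('d::finite) \<ge> 2"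
  shows "real CARD(('p::prime_card, 'd) Fvec) \<ge> 4"
proof -
  have p: "2 \<le> CARD('p)"
    by (rule prime_ge_2_nat[OF prime_card])
  then have "2 ^ 2 \<le> CARD('p) ^ 2"
    by (rule power_mono) simp
  also have "\<dots> \<le> CARD('p) ^ CARD('d)"
    using p assms by (intro power_increasing) auto
  finally have "4 \<le> CARD(('p, 'd) Fvec)"
    by simp
  then show ?thesis
    by linarith
qed

text \<open>
  If averaging hardly shortens the unit vector \<open>\<phi>\<close>, its translates are close to each other in
  mean square, hence so are the images of \<open>B\<close> under the linear parts.  The spectral gap then forces
  \<open>B\<close> to be nearly constant on the non-zero vectors.
\<close>

lemma almost_invariant_autocorrelation_flat:
  fixes \<phi> :: "('p::prime_card, 'd::finite) Fvec \<Rightarrow> real"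
  assumes d: "CARD('d) \<ge> 2" and prob: "prob_measure_on (carrier ASL) \<mu>"
    and gap: "theta_operator_norm \<mu> \<le> 1 / 2"
    and \<phi>: "(\<Sum>x\<in>UNIV. (\<phi> x)\<^sup>2) = 1"
    and inv: "(\<Sum>x\<in>UNIV. (measure_act \<mu> \<phi> x)\<^sup>2) \<ge> 1 - 1 / 2 ^ 16"
  defines "B \<equiv> \<lambda>x. sqrt (autocorrelation (\<lambda>y. (\<phi> y)\<^sup>2) x)"
  defines "\<beta> \<equiv> (\<Sum>x\<in>-{0}. B x) / card (-{0::('p, 'd) Fvec})"
  shows "(\<Sum>x\<in>-{0}. (B x - \<beta>)\<^sup>2) \<le> 1 / 64"
proof -
  let ?G = "carrier (ASL :: (('p, 'd) Fvec \<times> ('p, 'd) Fmat) monoid)"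
  let ?E = "\<Sum>x\<in>-{0}. (B x - \<beta>)\<^sup>2"
  have \<mu>0: "0 \<le> \<mu> g" if "g \<in> ?G" for g
    using prob that by (simp add: prob_measure_on_def)
  have \<mu>: "(\<Sum>g\<in>?G. \<mu> g) = 1"
    using prob by (simp add: prob_measure_on_def)
  have B2: "(\<Sum>x\<in>UNIV. (B x)\<^sup>2) = 1"
    by (simp add: B_def autocorrelation_nonneg sum_autocorrelation \<phi>)
  have "(theta_operator_norm \<mu>)\<^sup>2 \<le> (1 / 2)\<^sup>2"
    using gap theta_operator_norm_nonneg by (rule power_mono)
  then have "(3 / 4) * ?E \<le> (1 - (theta_operator_norm \<mu>)\<^sup>2) * ?E"
    by (intro mult_right_mono sum_nonneg) (auto simp: power2_eq_square)
  moreover have "(\<Sum>x\<in>UNIV. (linear_average \<mu> B x)\<^sup>2)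
      \<le> 1 - (1 - (theta_operator_norm \<mu>)\<^sup>2) * ?E"
    using linear_average_energy[OF d prob, of \<beta> B] by (simp add: \<beta>_def B2)
  ultimately have "(3 / 2) * ?E
      \<le> 2 * (\<Sum>x\<in>UNIV. (B x)\<^sup>2) - 2 * (\<Sum>x\<in>UNIV. (linear_average \<mu> B x)\<^sup>2)"
    by (simp add: B2)
  also have "\<dots> = (\<Sum>g\<in>?G. \<Sum>h\<in>?G. \<mu> g * \<mu> h *
      (\<Sum>x\<in>UNIV. (B (inv\<^bsub>SL\<^esub> (snd g) *v x) - B (inv\<^bsub>SL\<^esub> (snd h) *v x))\<^sup>2))"
    by (rule linear_average_pair_variance[OF prob, symmetric])
  \<comment> \<open>The mean square distance of the translates of \<phi> is at most 1 / 2 ^ 15; the weight 2 ^ 8 is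
    close to the optimal one for this value.\<close>
  also have "\<dots> \<le> (\<Sum>g\<in>?G. \<Sum>h\<in>?G. \<mu> g * \<mu> h *
      (2 * (2 ^ 8 * (\<Sum>x\<in>UNIV. (translate g \<phi> x - translate h \<phi> x)\<^sup>2) + 1 / 2 ^ 8)))"
    unfolding B_def
    by (intro sum_mono mult_left_mono sqrt_autocorrelation_displacement \<phi> mult_nonneg_nonneg \<mu>0) simp_all
  also have "\<dots> = 2 ^ 9 * (\<Sum>g\<in>?G. \<Sum>h\<in>?G. \<mu> g * \<mu> h *
      (\<Sum>x\<in>UNIV. (translate g \<phi> x - translate h \<phi> x)\<^sup>2))
      + (1 / 2 ^ 7) * ((\<Sum>g\<in>?G. \<mu> g) * (\<Sum>h\<in>?G. \<mu> h))"
    unfolding sum_product sum_distrib_left[of "2 ^ 9"] sum_distrib_left[of "1 / 2 ^ 7"]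
      sum.distrib[symmetric]
    by (intro sum.cong refl) (simp add: algebra_simps)
  also have "\<dots> = 2 ^ 9 * (2 - 2 * (\<Sum>x\<in>UNIV. (measure_act \<mu> \<phi> x)\<^sup>2)) + 1 / 2 ^ 7"
    by (simp only: measure_act_pair_variance[OF prob] \<phi> \<mu>) simp
  also have "\<dots> \<le> 3 / 128"
    using inv by simp
  finally show ?thesis
    by simp
qed

text \<open>
  Write \<open>q\<close> for the number of vectors and \<open>B\<close> for the square root of the autocorrelation of \<open>\<phi>\<^sup>2\<close>,
  whose square has mass \<open>1\<close>.  Away from \<open>0\<close>, this mass consists of the deviation of \<open>B\<close> from
  its mean \<open>\<beta>\<close>, at most \<open>1 / 64\<close>, and of the flat part \<open>(q - 1) * \<beta>\<^sup>2\<close>, which the bound on the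
  \<open>L\<^sup>1\<close> norm of \<open>\<phi>\<close> makes at most \<open>1 / 192\<close>.  Together this is \<open>1 / 48\<close>, and the remaining mass,
  \<open>B\<^sup>2\<close> at \<open>0\<close>, is the sum of \<open>\<phi>\<^sup>4\<close>.
\<close>

lemma almost_invariant_spread_concentrated:
  fixes \<phi> :: "('p::prime_card, 'd::finite) Fvec \<Rightarrow> real"
  assumes d: "CARD('d) \<ge> 2" and prob: "prob_measure_on (carrier ASL) \<mu>"
    and gap: "theta_operator_norm \<mu> \<le> 1 / 2"
    and \<phi>0: "\<And>x. 0 \<le> \<phi> x" and \<phi>: "(\<Sum>x\<in>UNIV. (\<phi> x)\<^sup>2) = 1"
    and inv: "(\<Sum>x\<in>UNIV. (measure_act \<mu> \<phi> x)\<^sup>2) \<ge> 1 - 1 / 2 ^ 16"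
    and small: "256 * (\<Sum>x\<in>UNIV. \<phi> x) ^ 4 \<le> CARD(('p, 'd) Fvec)"
  shows "(\<Sum>x\<in>UNIV. (\<phi> x) ^ 4) \<ge> 47 / 48"
proof -
  define B where "B x = sqrt (autocorrelation (\<lambda>y. (\<phi> y)\<^sup>2) x)" for x
  define \<beta> where "\<beta> = (\<Sum>x\<in>-{0}. B x) / card (-{0::('p, 'd) Fvec})"
  define q where "q = real CARD(('p, 'd) Fvec)"
  have flat: "(\<Sum>x\<in>-{0}. (B x - \<beta>)\<^sup>2) \<le> 1 / 64"
    using almost_invariant_autocorrelation_flat[OF d prob gap \<phi> inv]
    unfolding B_def \<beta>_def .
  define t where "t = (\<Sum>x\<in>UNIV. \<phi> x)"
  have small': "256 * t ^ 4 \<le> q"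
    using small by (simp only: q_def t_def)
  have q: "q \<ge> 4"
    unfolding q_def by (rule card_vectors_ge_4[OF d])
  have N: "real (card (-{0::('p, 'd) Fvec})) = q - 1"
    using q by (simp add: q_def Compl_eq_Diff_UNIV card_Diff_subset of_nat_diff)
  have B0: "0 \<le> B x" for x
    by (simp add: B_def autocorrelation_nonneg)
  have B2: "1 = B 0 ^ 2 + (\<Sum>x\<in>-{0}. (B x)\<^sup>2)"
  proof -
    have "(\<Sum>x\<in>UNIV. (B x)\<^sup>2) = 1"
      by (simp add: B_def autocorrelation_nonneg sum_autocorrelation \<phi>)
    then show ?thesis
      by (simp add: sum_split_zero)
  qed
  have sumB: "(\<Sum>x\<in>-{0}. B x) = (q - 1) * \<beta>"
    using q by (simp add: \<beta>_def N)
  have "(\<Sum>x\<in>-{0}. (B x)\<^sup>2) = (\<Sum>x\<in>-{0}. (\<beta> + (B x - \<beta>))\<^sup>2)"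
    by simp
  also have "\<dots> = (q - 1) * \<beta>\<^sup>2 + (\<Sum>x\<in>-{0}. (B x - \<beta>)\<^sup>2)"
    unfolding sum_square_shift by (simp add: sum_subtractf sumB N)
  also have "(q - 1) * \<beta>\<^sup>2 \<le> 1 / 192"
  proof -
    have "(q - 1) * \<beta> \<le> t\<^sup>2"
      using sum_sqrt_autocorrelation_le[of \<phi>, OF \<phi>0] B0[of 0] sumB
      by (simp add: sum_split_zero t_def flip: B_def)
    moreover have "0 \<le> (q - 1) * \<beta>"
      unfolding sumB[symmetric] by (intro sum_nonneg B0)
    ultimately have "((q - 1) * \<beta>)\<^sup>2 \<le> (t\<^sup>2)\<^sup>2"
      by (intro power_mono)
    moreover have "((q - 1) * \<beta>)\<^sup>2 = (q - 1) * ((q - 1) * \<beta>\<^sup>2)"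
      by (simp add: power2_eq_square)
    ultimately have "(q - 1) * ((q - 1) * \<beta>\<^sup>2) \<le> q / 256"
      using small' by simp
    also have "\<dots> \<le> (q - 1) * (1 / 192)"
      using q by simp
    finally show ?thesis
      using q by simp
  qed
  finally have "(B 0)\<^sup>2 \<ge> 47 / 48"
    using flat B2 by simp
  then show ?thesis
    by (simp add: B_def autocorrelation_zero sum_nonneg)
qed

text \<open>
  A unit vector with a large fourth moment carries almost all its mass at one point, where the
  hypothesis on point masses applies; the remaining part has norm at most \<open>sqrt (1 / 48)\<close> and is not
  enlarged by averaging.
\<close>

lemma concentrated_contracts:
  fixes \<phi> :: "('p::prime_card, 'd::finite) Fvec \<Rightarrow> real"
  assumes prob: "prob_measure_on (carrier ASL) \<mu>"
    and point: "\<And>x. L2_norm_on UNIV (measure_act \<mu> (point_mass x)) \<le> 3 / 4"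
    and \<phi>: "(\<Sum>x\<in>UNIV. (\<phi> x)\<^sup>2) = 1" and conc: "(\<Sum>x\<in>UNIV. (\<phi> x) ^ 4) \<ge> 47 / 48"
  shows "(\<Sum>x\<in>UNIV. (measure_act \<mu> \<phi> x)\<^sup>2) \<le> 4 / 5"
proof -
  obtain z where z: "\<And>x. (\<phi> x)\<^sup>2 \<le> (\<phi> z)\<^sup>2"
    using ex_is_arg_min_if_finite[of UNIV "\<lambda>x. - (\<phi> x)\<^sup>2"] by (auto simp: is_arg_min_linorder)
  have "(\<phi> x) ^ 4 \<le> (\<phi> z)\<^sup>2 * (\<phi> x)\<^sup>2" for x
    using mult_right_mono[OF z[of x], of "(\<phi> x)\<^sup>2"] by (simp flip: power_add)
  then have "47 / 48 \<le> (\<Sum>x\<in>UNIV. (\<phi> z)\<^sup>2 * (\<phi> x)\<^sup>2)"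
    by (intro order_trans[OF conc] sum_mono)
  then have large: "47 / 48 \<le> (\<phi> z)\<^sup>2"
    by (simp add: \<phi> flip: sum_distrib_left)
  define \<rho> where "\<rho> x = \<phi> x - \<phi> z * point_mass z x" for x
  let ?P = "measure_act \<mu> (point_mass z)"
  have "(\<Sum>x\<in>UNIV. (\<phi> x)\<^sup>2) = (\<phi> z)\<^sup>2 + (\<Sum>x\<in>-{z}. (\<phi> x)\<^sup>2)"
    using sum.remove[of UNIV z "\<lambda>x. (\<phi> x)\<^sup>2"] by (simp add: Compl_eq_Diff_UNIV)
  moreover have "(\<Sum>x\<in>UNIV. (\<rho> x)\<^sup>2) = (\<Sum>x\<in>-{z}. (\<phi> x)\<^sup>2)"
    using sum.remove[of UNIV z "\<lambda>x. (\<rho> x)\<^sup>2"]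
    by (simp add: Compl_eq_Diff_UNIV \<rho>_def point_mass_def)
  ultimately have \<rho>: "(\<Sum>x\<in>UNIV. (\<rho> x)\<^sup>2) = 1 - (\<phi> z)\<^sup>2"
    by (simp add: \<phi>)
  have P: "(\<Sum>x\<in>UNIV. (?P x)\<^sup>2) \<le> 9 / 16"
    using power_mono[OF point[of z], of 2]
    by (simp add: L2_norm_on_def L2_set_def sum_nonneg power2_eq_square)
  have "measure_act \<mu> \<phi> x = \<phi> z * ?P x + measure_act \<mu> \<rho> x" for x
    by (simp add: measure_act_def \<rho>_def sum_distrib_left algebra_simps flip: sum.distrib)
  \<comment> \<open>The weights 6 / 5 and 6 balance the two parts: 6 / 5 * (9 / 16) + 6 / 48 = 4 / 5.\<close>
  moreover have "(a + b)\<^sup>2 \<le> 6 / 5 * a\<^sup>2 + 6 * b\<^sup>2" for a b :: real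
    using zero_le_power2[of "a - 5 * b"] by (simp add: power2_eq_square algebra_simps)
  ultimately have "(\<Sum>x\<in>UNIV. (measure_act \<mu> \<phi> x)\<^sup>2)
      \<le> (\<Sum>x\<in>UNIV. 6 / 5 * (\<phi> z * ?P x)\<^sup>2 + 6 * (measure_act \<mu> \<rho> x)\<^sup>2)"
    by (simp add: sum_mono)
  also have "\<dots> = 6 / 5 * (\<phi> z)\<^sup>2 * (\<Sum>x\<in>UNIV. (?P x)\<^sup>2) + 6 * (\<Sum>x\<in>UNIV. (measure_act \<mu> \<rho> x)\<^sup>2)"
    by (simp add: sum.distrib sum_distrib_left power_mult_distrib mult.assoc)
  also have "\<dots> \<le> 6 / 5 * (\<phi> z)\<^sup>2 * (9 / 16) + 6 * (1 - (\<phi> z)\<^sup>2)"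
    using measure_act_L2_contraction[OF prob, of \<rho>] P unfolding \<rho>
    by (intro add_mono mult_left_mono) auto
  also have "\<dots> \<le> 4 / 5"
    using large by simp
  finally show ?thesis .
qed

text \<open>
  If the step shortened \<open>f\<close> by less than the stated factor, the normalisation of \<open>f\<close> would be
  almost invariant, hence concentrated at a point, hence strongly contracted after all.  The lower
  bound on the norm enters because normalising a probability density \<open>f\<close> produces a function
  with \<open>L\<^sup>1\<close> norm \<open>1 / \<parallel>f\<parallel>\<close>.
\<close>

lemma contraction_step:
  fixes f :: "('p::prime_card, 'd::finite) Fvec \<Rightarrow> real"
  assumes d: "CARD('d) \<ge> 2" and prob: "prob_measure_on (carrier ASL) \<mu>"
    and point: "\<And>x. L2_norm_on UNIV (measure_act \<mu> (point_mass x)) \<le> 3 / 4"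
    and gap: "theta_operator_norm \<mu> \<le> 1 / 2"
    and f0: "\<And>x. 0 \<le> f x" and f1: "(\<Sum>x\<in>UNIV. f x) = 1"
    and large: "L2_norm_on UNIV f ^ 4 \<ge> 256 / CARD(('p, 'd) Fvec)"
  shows "L2_norm_on UNIV (measure_act \<mu> f) \<le> (1 - 1 / 2 ^ 17) * L2_norm_on UNIV f"
proof -
  define s where "s = L2_norm_on UNIV f"
  define q where "q = real CARD(('p, 'd) Fvec)"
  have q: "q > 0"
    by (simp add: q_def)
  have s0: "s \<ge> 0"
    by (simp add: s_def L2_norm_on_def)
  have s4: "s ^ 4 \<ge> 256 / q"
    using large by (simp add: s_def q_def)
  have s: "s > 0"
    using s0 s4 q by (cases "s = 0") auto
  have s2: "s\<^sup>2 = (\<Sum>x\<in>UNIV. (f x)\<^sup>2)"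
    by (simp add: s_def L2_norm_on_def L2_set_def sum_nonneg)
  define \<phi> where "\<phi> x = f x / s" for x
  have \<phi>: "(\<Sum>x\<in>UNIV. (\<phi> x)\<^sup>2) = 1"
    using s by (simp add: \<phi>_def power_divide flip: sum_divide_distrib s2)
  have \<phi>0: "0 \<le> \<phi> x" for x
    using f0 s by (simp add: \<phi>_def)
  have sum_\<phi>: "(\<Sum>x\<in>UNIV. \<phi> x) = 1 / s"
    by (simp add: \<phi>_def f1 flip: sum_divide_distrib)
  have "256 * (1 / s) ^ 4 \<le> q"
    using s4 s q by (simp add: power_divide field_simps)
  then have small: "256 * (\<Sum>x\<in>UNIV. \<phi> x) ^ 4 \<le> CARD(('p, 'd) Fvec)"
    by (simp only: sum_\<phi> q_def)
  have "\<not> (\<Sum>x\<in>UNIV. (measure_act \<mu> \<phi> x)\<^sup>2) \<ge> 1 - 1 / 2 ^ 16"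
  proof
    assume "(\<Sum>x\<in>UNIV. (measure_act \<mu> \<phi> x)\<^sup>2) \<ge> 1 - 1 / 2 ^ 16"
    moreover from almost_invariant_spread_concentrated[OF d prob gap \<phi>0 \<phi> this small]
    have "(\<Sum>x\<in>UNIV. (measure_act \<mu> \<phi> x)\<^sup>2) \<le> 4 / 5"
      by (rule concentrated_contracts[OF prob point \<phi>])
    ultimately show False
      by simp
  qed
  \<comment> \<open>The threshold 1 - 1 / 2 ^ 16 is the first-order part of this square.\<close>
  then have "(\<Sum>x\<in>UNIV. (measure_act \<mu> \<phi> x)\<^sup>2) \<le> (1 - 1 / 2 ^ 17)\<^sup>2"
    by (simp add: power2_eq_square)
  moreover have "measure_act \<mu> f x = s * measure_act \<mu> \<phi> x" for x
    using s by (simp add: measure_act_def \<phi>_def flip: sum_divide_distrib)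
  ultimately have "(\<Sum>x\<in>UNIV. (measure_act \<mu> f x)\<^sup>2) \<le> s\<^sup>2 * (1 - 1 / 2 ^ 17)\<^sup>2"
    by (simp add: power_mult_distrib mult_left_mono flip: sum_distrib_left)
  moreover have "(L2_norm_on UNIV (measure_act \<mu> f))\<^sup>2 = (\<Sum>x\<in>UNIV. (measure_act \<mu> f x)\<^sup>2)"
    by (simp add: L2_norm_on_def L2_set_def sum_nonneg)
  ultimately have "(L2_norm_on UNIV (measure_act \<mu> f))\<^sup>2 \<le> ((1 - 1 / 2 ^ 17) * s)\<^sup>2"
    by (simp only: power_mult_distrib mult.commute)
  then have "L2_norm_on UNIV (measure_act \<mu> f) \<le> (1 - 1 / 2 ^ 17) * s"
    by (rule power2_le_imp_le) (simp add: s0)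
  then show ?thesis
    by (simp only: s_def)
qed

section \<open>Decay along the walk\<close>

lemma Linf_norm_le_L2_norm:
  fixes f :: "'a \<Rightarrow> 'b::real_normed_vector"
  assumes "finite A" "A \<noteq> {}"
  shows "Linf_norm_on A f \<le> L2_norm_on A f"
  using assms member_le_L2_set[OF assms(1), of _ "\<lambda>x. norm (f x)"]
  by (auto simp: Linf_norm_on_def L2_norm_on_def)

lemma L2_norm_measure_act_le:
  fixes f :: "('p::prime_card, 'd::finite) Fvec \<Rightarrow> real"
  assumes "prob_measure_on (carrier ASL) \<mu>"
  shows "L2_norm_on UNIV (measure_act \<mu> f) \<le> L2_norm_on UNIV f"
  using measure_act_L2_contraction[OF assms, of f] by (simp add: L2_norm_on_def L2_set_def)

lemma walk_density:
  assumes prob: "prob_measure_on (carrier ASL) \<mu>"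
  shows "0 \<le> measure_act (conv_power ASL \<mu> k) (point_mass v) x"
    and "(\<Sum>x\<in>UNIV. measure_act (conv_power ASL \<mu> k) (point_mass v) x) = 1"
proof -
  have "(\<forall>x. 0 \<le> measure_act (conv_power ASL \<mu> k) (point_mass v) x)
    \<and> (\<Sum>x\<in>UNIV. measure_act (conv_power ASL \<mu> k) (point_mass v) x) = 1"
  proof (induction k)
    case 0
    show ?case
      unfolding conv_power.simps measure_act_point_mass_one by (simp add: point_mass_def)
  next
    case (Suc k)
    then show ?case
      by (simp add: measure_act_convolution sum_measure_act[OF prob] measure_act_nonneg[OF prob])
  qed
  then show "0 \<le> measure_act (conv_power ASL \<mu> k) (point_mass v) x"
    and "(\<Sum>x\<in>UNIV. measure_act (conv_power ASL \<mu> k) (point_mass v) x) = 1"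
    by auto
qed

text \<open>
  Above the threshold \<open>K\<close> every step gains the factor \<open>1 - 1 / 2 ^ 17\<close>; once below it, the norm
  stays there.
\<close>

lemma walk_L2_decay:
  fixes v :: "('p::prime_card, 'd::finite) Fvec"
  assumes d: "CARD('d) \<ge> 2" and prob: "prob_measure_on (carrier ASL) \<mu>"
    and point: "\<And>x. L2_norm_on UNIV (measure_act \<mu> (point_mass x)) \<le> 3 / 4"
    and gap: "theta_operator_norm \<mu> \<le> 1 / 2"
    and K: "K ^ 4 = 256 / CARD(('p, 'd) Fvec)" "K \<ge> 0"
  shows "L2_norm_on UNIV (measure_act (conv_power ASL \<mu> k) (point_mass v))
    \<le> max ((1 - 1 / 2 ^ 17) ^ k) K"
proof (induction k)
  case 0
  have "(\<Sum>x\<in>UNIV. (point_mass v x)\<^sup>2) = (\<Sum>x\<in>UNIV. point_mass v x)"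
    by (intro sum.cong) (auto simp: point_mass_def)
  also have "\<dots> = 1"
    by (simp add: point_mass_def)
  finally show ?case
    unfolding conv_power.simps measure_act_point_mass_one by (simp add: L2_norm_on_def L2_set_def)
next
  case (Suc k)
  let ?f = "measure_act (conv_power ASL \<mu> k) (point_mass v)"
  have step: "measure_act (conv_power ASL \<mu> (Suc k)) (point_mass v) = measure_act \<mu> ?f"
    by (simp add: measure_act_convolution)
  show ?case
  proof (cases "L2_norm_on UNIV ?f \<le> K")
    case True
    then show ?thesis
      unfolding step using L2_norm_measure_act_le[OF prob, of ?f] by linarith
  next
    case False
    then have "K ^ 4 \<le> L2_norm_on UNIV ?f ^ 4"
      using K by (intro power_mono) auto
    then have "L2_norm_on UNIV (measure_act \<mu> ?f) \<le> (1 - 1 / 2 ^ 17) * L2_norm_on UNIV ?f"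
      using K by (intro contraction_step d prob point gap walk_density) auto
    also have "\<dots> \<le> (1 - 1 / 2 ^ 17) * (1 - 1 / 2 ^ 17) ^ k"
      using Suc.IH False by (intro mult_left_mono) auto
    finally show ?thesis
      unfolding step power_Suc by (rule order_trans[OF _ max.cobounded1])
  qed
qed

text \<open>
  The rate \<open>1 / 2 ^ 17\<close> and the length \<open>2 ^ 15 * d * ln p\<close> multiply to \<open>(d / 4) * ln p\<close>.  Rounding
  the length to an integer costs less than one step, which the factor \<open>4\<close> absorbs.
\<close>

lemma geometric_decay_le_powr:
  fixes p d :: real and l :: nat
  assumes p: "p > 0" and l: "real l \<ge> 2 ^ 15 * d * ln p - 1"
  shows "(1 - 1 / 2 ^ 17) ^ l \<le> 4 * p powr (- d / 4)"
proof -
  have "(1 - 1 / 2 ^ 17 :: real) ^ l \<le> exp (- (1 / 2 ^ 17)) ^ l"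
    using exp_ge_add_one_self[of "- (1 / 2 ^ 17)"] by (intro power_mono) auto
  also have "\<dots> = exp (- (1 / 2 ^ 17) * l)"
    by (simp flip: exp_of_nat_mult add: mult.commute)
  also have "\<dots> \<le> exp (1 + (- d / 4) * ln p)"
    using l by simp
  also have "\<dots> = exp 1 * p powr (- d / 4)"
    unfolding exp_add using p by (simp add: powr_def)
  also have "\<dots> \<le> 4 * p powr (- d / 4)"
    using exp_le by (intro mult_right_mono) auto
  finally show ?thesis .
qed

theorem proposition3:
  fixes \<mu> :: "('p::prime_card mod_ring ^ 'd::finite) \<times> ('p mod_ring ^ 'd ^ 'd) \<Rightarrow> real"
    and v\<^sub>0 :: "'p mod_ring ^ 'd"
    and \<eta> :: "nat \<Rightarrow> 'p mod_ring ^ 'd \<Rightarrow> real"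
    and p d l :: nat
  assumes "p = CARD('p)" and "d = CARD('d)" and "d \<ge> 2"
    and "prob_measure_on (carrier ASL) \<mu>"
    and "symmetric_measure ASL \<mu>"
    and "\<And>x. L2_norm_on UNIV (measure_act \<mu> (point_mass x)) \<le> 3 / 4"
    and "theta_operator_norm \<mu> \<le> 1 / 2"
    and "\<And>k. \<eta> k = measure_act (conv_power ASL \<mu> k) (point_mass v\<^sub>0)"
    and "l = nat \<lfloor>2 ^ 15 * real d * ln (real p)\<rfloor>"
  shows "Linf_norm_on UNIV (\<eta> l) \<le> L2_norm_on UNIV (\<eta> l)
    \<and> L2_norm_on UNIV (\<eta> l) \<le> 4 * real p powr (- real d / 4)"
proof
  show "Linf_norm_on UNIV (\<eta> l) \<le> L2_norm_on UNIV (\<eta> l)"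
    by (intro Linf_norm_le_L2_norm) auto
  let ?K = "4 * real p powr (- real d / 4)"
  have p: "real p > 0"
    using assms(1) by simp
  have "?K ^ 4 = 256 * real p powr (- real d)"
    using p by (simp add: power_mult_distrib powr_power)
  also have "\<dots> = 256 / CARD('p mod_ring ^ 'd)"
    using p by (simp add: powr_minus powr_realpow assms(1,2) divide_simps)
  finally have K: "?K ^ 4 = 256 / CARD('p mod_ring ^ 'd)" .
  have "L2_norm_on UNIV (\<eta> l) \<le> max ((1 - 1 / 2 ^ 17) ^ l) ?K"
    unfolding assms(8) using assms(2,3) by (intro walk_L2_decay assms K) auto
  moreover have "(1 - 1 / 2 ^ 17) ^ l \<le> ?K"
    using p by (rule geometric_decay_le_powr) (unfold assms(9), linarith)
  ultimately show "L2_norm_on UNIV (\<eta> l) \<le> ?K"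
    by linarith
qed

end
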